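(* In a symmetric Minkowski plane $\mathcal{M}=(\mathcal{P},\Lambda,\Sigma_1\cup\Sigma_2)$, for every circle $I$ the circle symmetry $S_I$ is an automorphism of $\mathcal{M}$, i.e. it maps every circle onto a circle (and generators onto generators).
   Context: A hyperbola structure is a triple $\mathcal{M}=(\mathcal{P},\Lambda,\Sigma_1\cup\Sigma_2)$, where $\mathcal{P}$ is a nonempty set (points) and $\Lambda,\Sigma_1,\Sigma_2$ are nonempty sets of subsets of $\mathcal{P}$ with $\Sigma_1\cap\Sigma_2=\emptyset$ (elements of $\Lambda$ are circles, elements of $\Sigma_1\cup\Sigma_2$ are generators), such that: (H1) for each point $p$ and $i\in\{1,2\}$ there is exactly one $G\in\Sigma_i$ with $p\in G$, denoted $[p]_i$; (H2) any $A\in\Sigma_1$ and $B\in\Sigma_2$ meet in exactly one point; (H3) every generator meets every circle in exactly one point; (H4) for any three distinct points $a,b,c$ with $[a]_i\neq[b]_i\neq[c]_i\neq[a]_i$ for $i=1,2$ there is exactly one circle containing $a,b,c$; (H5) some circle contains at least three points. For points $p,q$, $pq$ denotes the unique point of $[p]_1\cap[q]_2$. For a circle $K$, the circle symmetry $S_K:\mathcal{P}\to\mathcal{P}$ sends $p$ to the unique point $q$ with $pq\in K$ and $qp\in K$; it is an involutory bijection fixing $K$ pointwise and interchanging $\Sigma_1$ and $\Sigma_2$. Two distinct circles $K,L$ are orthogonal ($K\perp L$) if $S_K(p)=p$ for every $p\in L$. Symmetry axiom (S): for any circles $K,L$ and any point $p\in L\setminus K$, if $S_K(p)\in L$ then $K\perp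 L$. A symmetric Minkowski plane is a hyperbola structure satisfying (S). An automorphism of $\mathcal{M}$ is a bijection of $\mathcal{P}$ mapping $\Lambda$ onto $\Lambda$ and $\Sigma_1\cup\Sigma_2$ onto $\Sigma_1\cup\Sigma_2$.
   Formalization: Orthogonality K ⊥ L is read as K ≠ L and S_K(p) ∈ L for every p in L (S_K maps L onto itself), instead of S_K(p) = p for every p in L; with the latter no hyperbola structure satisfies the symmetry axiom (S). *)

theory Defs
  imports Main
begin

text \<open>
  A structure is given by its point set \<open>P\<close>, its set of circles \<open>C\<close> and the two
  classes of generators \<open>S1\<close>, \<open>S2\<close>. The definite descriptions below are only
  meaningful in a hyperbola structure, where they are well defined by (H1)-(H3).
\<close>

text \<open>The generator \<open>[p]\<^sub>i\<close> is \<open>gen_through Si p\<close>.\<close>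

definition gen_through :: "'a set set \<Rightarrow> 'a \<Rightarrow> 'a set" where
  "gen_through S p = (THE G. G \<in> S \<and> p \<in> G)"

locale hyperbola_structure =
  fixes P :: "'a set" and C S1 S2 :: "'a set set"
  assumes points_nonempty: "P \<noteq> {}"
    and circles_subset: "C \<subseteq> Pow P"
    and gens1_subset: "S1 \<subseteq> Pow P"
    and gens2_subset: "S2 \<subseteq> Pow P"
    and circles_nonempty: "C \<noteq> {}"
    and gens1_nonempty: "S1 \<noteq> {}"
    and gens2_nonempty: "S2 \<noteq> {}"
    and gens_disjoint: "S1 \<inter> S2 = {}"
    and H1: "\<And>p S. p \<in> P \<Longrightarrow> S \<in> {S1, S2} \<Longrightarrow> \<exists>!G. G \<in> S \<and> p \<in> G"
    and H2: "\<And>A B. A \<in> S1 \<Longrightarrow> B \<in> S2 \<Longrightarrow> \<exists>!x. x \<in> A \<inter> B"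
    and H3: "\<And>G K. G \<in> S1 \<union> S2 \<Longrightarrow> K \<in> C \<Longrightarrow> \<exists>!x. x \<in> G \<inter> K"
    and H4: "\<And>a b c. a \<in> P \<Longrightarrow> b \<in> P \<Longrightarrow> c \<in> P \<Longrightarrow>
      a \<noteq> b \<Longrightarrow> b \<noteq> c \<Longrightarrow> c \<noteq> a \<Longrightarrow>
      (\<And>S. S \<in> {S1, S2} \<Longrightarrow>
        gen_through S a \<noteq> gen_through S b \<and>
        gen_through S b \<noteq> gen_through S c \<and>
        gen_through S c \<noteq> gen_through S a) \<Longrightarrow>
      \<exists>!K. K \<in> C \<and> a \<in> K \<and> b \<in> K \<and> c \<in> K"
    and H5: "\<exists>K\<in>C. \<exists>a\<in>K. \<exists>b\<in>K. \<exists>c\<in>K. a \<noteq> b \<and> b \<noteq> c \<and> c \<noteq> a"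

text \<open>The point \<open>pq\<close>.\<close>

definition gen_meet :: "'a set set \<Rightarrow> 'a set set \<Rightarrow> 'a \<Rightarrow> 'a \<Rightarrow> 'a" where
  "gen_meet S1 S2 p q = (THE x. x \<in> gen_through S1 p \<inter> gen_through S2 q)"

definition circle_symmetry ::
    "'a set \<Rightarrow> 'a set set \<Rightarrow> 'a set set \<Rightarrow> 'a set \<Rightarrow> 'a \<Rightarrow> 'a" where
  "circle_symmetry P S1 S2 K p =
     (THE q. q \<in> P \<and> gen_meet S1 S2 p q \<in> K \<and> gen_meet S1 S2 q p \<in> K)"

text \<open>
  Orthogonality means that the symmetry in \<open>K\<close> leaves \<open>L\<close> invariant as a set.
  Invariance cannot be replaced by pointwise fixing of \<open>L\<close>: \<open>S\<^sub>K\<close> fixes only the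
  points of \<open>K\<close>, and with that variant no hyperbola structure would satisfy the
  symmetry axiom; see \<open>pointwise_symmetry_axiom_fails\<close> below. Since pointwise fixing
  implies invariance, the symmetry axiom used here is the weaker hypothesis of the two.
\<close>

definition orthogonal ::
    "'a set \<Rightarrow> 'a set set \<Rightarrow> 'a set set \<Rightarrow> 'a set \<Rightarrow> 'a set \<Rightarrow> bool" where
  "orthogonal P S1 S2 K L \<longleftrightarrow> K \<noteq> L \<and> (\<forall>p\<in>L. circle_symmetry P S1 S2 K p \<in> L)"

locale symmetric_minkowski_plane = hyperbola_structure P C S1 S2
  for P :: "'a set" and C S1 S2 :: "'a set set" +
  assumes symmetry_axiom: "\<And>K L p. K \<in> C \<Longrightarrow> L \<in> C \<Longrightarrow> p \<in> L - K \<Longrightarrow>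
    circle_symmetry P S1 S2 K p \<in> L \<Longrightarrow> orthogonal P S1 S2 K L"

definition plane_automorphism ::
    "'a set \<Rightarrow> 'a set set \<Rightarrow> 'a set set \<Rightarrow> 'a set set \<Rightarrow> ('a \<Rightarrow> 'a) \<Rightarrow> bool" where
  "plane_automorphism P C S1 S2 f \<longleftrightarrow>
     bij_betw f P P \<and> (`) f ` C = C \<and> (`) f ` (S1 \<union> S2) = S1 \<union> S2"

context hyperbola_structure
begin

lemma gen_through:
  assumes "p \<in> P" "S \<in> {S1, S2}"
  shows "gen_through S p \<in> S" "p \<in> gen_through S p"
  using theI'[OF H1[OF assms]] unfolding gen_through_def by auto

lemma gen_through_eq:
  assumes "G \<in> S" "p \<in> G" "S \<in> {S1, S2}"
  shows "gen_through S p = G"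
proof -
  have "p \<in> P" using assms gens1_subset gens2_subset by auto
  show ?thesis unfolding gen_through_def
    by (rule the1_equality[OF H1[OF \<open>p \<in> P\<close> assms(3)]]) (simp add: assms)
qed

lemma gen_meet:
  assumes "p \<in> P" "q \<in> P"
  shows "gen_meet S1 S2 p q \<in> gen_through S1 p" "gen_meet S1 S2 p q \<in> gen_through S2 q"
    "gen_meet S1 S2 p q \<in> P"
    "gen_through S1 (gen_meet S1 S2 p q) = gen_through S1 p"
    "gen_through S2 (gen_meet S1 S2 p q) = gen_through S2 q"
proof -
  have g: "gen_through S1 p \<in> S1" "gen_through S2 q \<in> S2"
    using gen_through(1)[OF assms(1), of S1] gen_through(1)[OF assms(2), of S2] by auto
  show m: "gen_meet S1 S2 p q \<in> gen_through S1 p" "gen_meet S1 S2 p q \<in> gen_through S2 q"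
    using theI'[OF H2[OF g]] unfolding gen_meet_def by auto
  show "gen_meet S1 S2 p q \<in> P" using m(1) g(1) gens1_subset by auto
  show "gen_through S1 (gen_meet S1 S2 p q) = gen_through S1 p"
    "gen_through S2 (gen_meet S1 S2 p q) = gen_through S2 q"
    using gen_through_eq[OF g(1) m(1)] gen_through_eq[OF g(2) m(2)] by auto
qed

lemma gen_meet_unique:
  assumes "p \<in> P" "q \<in> P" "x \<in> gen_through S1 p" "x \<in> gen_through S2 q"
  shows "gen_meet S1 S2 p q = x"
  unfolding gen_meet_def
  by (rule the1_equality[OF H2]) (simp_all add: assms gen_through)

lemma circle_symmetry_ex1:
  assumes "K \<in> C" "p \<in> P"
  shows "\<exists>!q. q \<in> P \<and> gen_meet S1 S2 p q \<in> K \<and> gen_meet S1 S2 q p \<in> K"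
proof -
  have g: "gen_through S1 p \<in> S1" "gen_through S2 p \<in> S2"
    using gen_through(1)[OF assms(2), of S1] gen_through(1)[OF assms(2), of S2] by auto
  obtain x where x: "x \<in> gen_through S1 p" "x \<in> K" using H3[of "gen_through S1 p" K] g assms by blast
  obtain y where y: "y \<in> gen_through S2 p" "y \<in> K" using H3[of "gen_through S2 p" K] g assms by blast
  have xy: "x \<in> P" "y \<in> P" using x y assms circles_subset by auto
  let ?q = "gen_meet S1 S2 y x"
  show ?thesis
  proof (rule ex1I[of _ ?q])
    have a: "x \<in> gen_through S2 ?q" and b: "y \<in> gen_through S1 ?q"
      using gen_meet(4,5)[OF xy(2,1)] gen_through(2)[OF xy(1), of S2] gen_through(2)[OF xy(2), of S1] by auto
    have "gen_meet S1 S2 p ?q = x" "gen_meet S1 S2 ?q p = y"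
      using a b gen_meet_unique[of p ?q x] gen_meet_unique[of ?q p y] gen_meet(3)[OF xy(2,1)] assms x y by auto
    then show "?q \<in> P \<and> gen_meet S1 S2 p ?q \<in> K \<and> gen_meet S1 S2 ?q p \<in> K"
      using gen_meet xy x y by auto
  next
    fix q assume q: "q \<in> P \<and> gen_meet S1 S2 p q \<in> K \<and> gen_meet S1 S2 q p \<in> K"
    have "gen_meet S1 S2 p q = x"
      using H3[of "gen_through S1 p" K] g assms q x gen_meet[of p q] by blast
    moreover have "gen_meet S1 S2 q p = y"
      using H3[of "gen_through S2 p" K] g assms q y gen_meet[of q p] by blast
    ultimately have "gen_through S2 x = gen_through S2 q" "gen_through S1 y = gen_through S1 q"
      using gen_meet(5)[of p q] gen_meet(4)[of q p] q assms by metis+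
    then show "q = ?q"
      using gen_meet_unique[OF xy(2) xy(1), of q] q gen_through(2)[of q S1] gen_through(2)[of q S2]
      by simp
  qed
qed

lemma pointwise_symmetry_axiom_fails:
  "\<exists>K\<in>C. \<exists>L\<in>C. \<exists>p\<in>L - K. circle_symmetry P S1 S2 K p \<in> L \<and>
     \<not> (\<forall>x\<in>L. circle_symmetry P S1 S2 K x = x)"
proof -
  obtain K a b c where K: "K \<in> C" "a \<in> K" "b \<in> K" "c \<in> K" "a \<noteq> b" "b \<noteq> c" "c \<noteq> a"
    using H5 by blast
  have abc: "a \<in> P" "b \<in> P" "c \<in> P" using K circles_subset by auto
  have d: "gen_through S x \<noteq> gen_through S y"
    if "x \<in> K" "y \<in> K" "x \<noteq> y" "S \<in> {S1, S2}" for x y S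
  proof
    assume e: "gen_through S x = gen_through S y"
    have "x \<in> P" "y \<in> P" using that K circles_subset by auto
    then have "x \<in> gen_through S x \<inter> K" "y \<in> gen_through S x \<inter> K" "gen_through S x \<in> S1 \<union> S2"
      using e that gen_through[of x S] gen_through[of y S] by auto
    then show False using H3[of "gen_through S x" K] K that by blast
  qed
  let ?p = "gen_meet S1 S2 a b" and ?q = "gen_meet S1 S2 b a"
  note m = gen_meet[OF abc(1,2)] gen_meet[OF abc(2,1)]
  have mm: "gen_meet S1 S2 ?p ?q = a" "gen_meet S1 S2 ?q ?p = b"
    using gen_meet_unique[of ?p ?q a] gen_meet_unique[of ?q ?p b] m abc
      gen_through(2)[of a S1] gen_through(2)[of a S2] gen_through(2)[of b S1] gen_through(2)[of b S2]
    by simp_all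
  have s: "circle_symmetry P S1 S2 K ?p = ?q"
    unfolding circle_symmetry_def
    by (rule the1_equality[OF circle_symmetry_ex1]) (use m(3,8) mm K(1-3) in auto)
  have pq: "?p \<noteq> ?q" "?p \<noteq> c" "?q \<noteq> c"
    using d[OF K(2,3,5), of S1] d[OF K(3,4,6), of S1] d[OF K(4,2,7), of S1] m(4) m(9) by auto
  have pK: "?p \<notin> K"
  proof
    assume "?p \<in> K"
    then have "?p = a" using d[of ?p a S1] m(4) K(2) by auto
    moreover have "?p = b" using d[of ?p b S2] \<open>?p \<in> K\<close> m(5) K(3) by auto
    ultimately show False using K by simp
  qed
  have n: "gen_through S a \<noteq> gen_through S b" "gen_through S b \<noteq> gen_through S c"
    "gen_through S c \<noteq> gen_through S a" if "S \<in> {S1, S2}" for S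
    using d[OF K(2,3,5) that] d[OF K(3,4,6) that] d[OF K(4,2,7) that] by auto
  have "\<exists>!L. L \<in> C \<and> ?p \<in> L \<and> ?q \<in> L \<and> c \<in> L"
  proof (rule H4)
    fix S assume "S \<in> {S1, S2}"
    then consider "S = S1" | "S = S2" by auto
    then show "gen_through S ?p \<noteq> gen_through S ?q \<and> gen_through S ?q \<noteq> gen_through S c \<and>
      gen_through S c \<noteq> gen_through S ?p"
    proof cases
      case 1
      show ?thesis unfolding 1 m(4,9) using n[of S1] by simp
    next
      case 2
      have "S2 \<in> {S1, S2}" by simp
      then show ?thesis unfolding 2 m(5,10)
        by (intro conjI n[THEN not_sym])
    qed
  qed (fact m(3,8) abc pq pq[symmetric])+
  then obtain L where L: "L \<in> C" "?p \<in> L" "?q \<in> L" by blast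
  have "\<not> (\<forall>x\<in>L. circle_symmetry P S1 S2 K x = x)"
  proof
    assume "\<forall>x\<in>L. circle_symmetry P S1 S2 K x = x"
    from bspec[OF this L(2)] s pq(1) show False by simp
  qed
  moreover have "circle_symmetry P S1 S2 K ?p \<in> L" using s L(3) by simp
  moreover have "?p \<in> L - K" using L(2) pK by simp
  ultimately show ?thesis using K(1) L(1) by (intro bexI[of _ K] bexI[of _ L] bexI[of _ ?p] conjI)
qed

end

end

theory Submission
  imports Defs "HOL-Combinatorics.Permutations"
begin

text \<open>
  Identify a point \<open>p\<close> with the pair of points in which its two generators meet the circle \<open>I\<close>. Then
  \<open>S\<^sub>I\<close> is the swap of coordinates, and the circles are the graphs of a sharply
  3-transitive set \<open>F\<close> of permutations of \<open>I\<close> that contains the identity. What has to be shown is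
  that \<open>F\<close> is closed under inversion.

  The source of all closure properties is this: if a transitive set \<open>T\<close> of permutations is
  inverted by involutions \<open>j\<close> (that is, \<open>t j t = j\<close>) that move any point to any other, then \<open>T\<close> is
  an abelian group. By (S) this applies to the members of \<open>F\<close> with two given fixed points
  \<open>p, q\<close>, inverted by those that swap \<open>p\<close> and \<open>q\<close>, and to the members that fix only \<open>p\<close>, inverted
  by the involutions that fix \<open>p\<close>. Hence members of \<open>F\<close> with a fixed point have their inverse in \<open>F\<close>.

  The circles through \<open>(p, p)\<close> form an affine plane. Its translations along the classes
  orthogonal to different circles commute, so tangent circles give the same
  translations whatever circle serves as identity, and the members of \<open>F\<close> that fix \<open>p\<close> form a group.
  With this group a member without fixed points is reduced to one that swaps two points.
\<close>

section \<open>Transitive families of permutations inverted by involutions\<close>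

locale inverted_family =
  fixes Y :: "'a set" and T J :: "('a \<Rightarrow> 'a) set"
  assumes perm: "t \<in> T \<Longrightarrow> t permutes Y"
    and nonempty: "Y \<noteq> {}"
    and trans: "u \<in> Y \<Longrightarrow> v \<in> Y \<Longrightarrow> \<exists>t\<in>T. t u = v"
    and invol: "j \<in> J \<Longrightarrow> j (j x) = x"
    and inverts: "t \<in> T \<Longrightarrow> j \<in> J \<Longrightarrow> t (j (t x)) = j x"
    and moves: "u \<in> Y \<Longrightarrow> v \<in> Y \<Longrightarrow> u \<noteq> v \<Longrightarrow> \<exists>j\<in>J. j u = v"
begin

text \<open>If \<open>j x = a (b x)\<close>, inverting twice gives
  \<open>a (b (j (b (a x)))) = j x = a (b x)\<close>, so \<open>j\<close> sends
  \<open>b (a x)\<close> to \<open>x\<close> and \<open>b (a x) = j x\<close>. Such a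
  \<open>j\<close> may be missing only when \<open>a (b x) = x\<close>, and if both products fix
  \<open>x\<close> they agree.\<close>

lemma commute:
  assumes "s \<in> T" "t \<in> T"
  shows "s (t x) = t (s x)"
proof -
  have key: "a (b x) = b (a x)" if "a \<in> T" "b \<in> T" "a (b x) \<noteq> x" "x \<in> Y" for a b
  proof -
    note ab = that
    have "a (b x) \<in> Y" using that perm by (simp add: permutes_in_image)
    then obtain j where j: "j \<in> J" "j x = a (b x)" using moves[of x "a (b x)"] ab by metis
    have "a (b (j (b (a x)))) = j x"
      using inverts[of b j "a x"] inverts[of a j x] that j by simp
    then have "j (b (a x)) = x"
      using j that perm by (metis permutes_inj injD)
    then show ?thesis using j invol by metis
  qed
  show ?thesis
  proof (cases "x \<in> Y")
    case True
    then show ?thesis using key[OF assms] key[OF assms(2,1)] by metis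
  next
    case False
    then show ?thesis using assms perm by (metis permutes_not_in)
  qed
qed

text \<open>A map that commutes with a transitive family is determined by one value, so equality of
  two such maps can be checked at one point.\<close>

lemma eq_if_commute:
  assumes "a permutes Y" "b permutes Y" "u \<in> Y" "a u = b u"
    and "\<And>t x. t \<in> T \<Longrightarrow> a (t x) = t (a x)" "\<And>t x. t \<in> T \<Longrightarrow> b (t x) = t (b x)"
  shows "a = b"
proof
  fix x
  show "a x = b x"
  proof (cases "x \<in> Y")
    case True
    then obtain t where "t \<in> T" "t u = x" using trans assms(3) by blast
    then show ?thesis using assms(4-6) by metis
  next
    case False
    then show ?thesis using assms(1,2) by (simp add: permutes_not_in)
  qed
qed

lemma comp_closed:
  assumes "s \<in> T" "t \<in> T"
  shows "s \<circ> t \<in> T"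
proof -
  obtain u where u: "u \<in> Y" using nonempty by blast
  have st: "(s \<circ> t) permutes Y" using assms perm by (simp add: permutes_compose)
  then obtain r where r: "r \<in> T" "r u = (s \<circ> t) u"
    using trans[of u "(s \<circ> t) u"] u permutes_in_image by metis
  have "r = s \<circ> t"
    by (rule eq_if_commute[OF perm[OF r(1)] st u r(2)])
      (use r assms commute in \<open>(metis comp_apply)+\<close>)
  then show ?thesis using r by simp
qed

lemma inv_closed:
  assumes "t \<in> T"
  shows "inv t \<in> T"
proof -
  obtain u where u: "u \<in> Y" using nonempty by blast
  then obtain h where h: "h \<in> T" "h (t u) = u"
    using trans[of "t u" u] assms perm by (auto simp: permutes_in_image)
  have "h \<circ> t = id"
    by (rule eq_if_commute[OF perm[OF comp_closed[OF h(1) assms]] permutes_id u])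
      (use h assms comp_closed[of h t] commute in auto)
  then have "inv t = h"
    using perm[OF assms] by (metis inv_unique_comp permutes_inv_o(1) comp_assoc comp_id id_comp)
  then show ?thesis using h by simp
qed

end

section \<open>Sharply 3-transitive permutations and the symmetry axiom\<close>

definition fix1 :: "('a \<Rightarrow> 'a) set \<Rightarrow> 'a \<Rightarrow> ('a \<Rightarrow> 'a) set" where
  "fix1 F p = {f \<in> F. f p = p}"

definition fix2 :: "('a \<Rightarrow> 'a) set \<Rightarrow> 'a \<Rightarrow> 'a \<Rightarrow> ('a \<Rightarrow> 'a) set" where
  "fix2 F p q = {f \<in> F. f p = p \<and> f q = q}"

definition swaps :: "('a \<Rightarrow> 'a) set \<Rightarrow> 'a \<Rightarrow> 'a \<Rightarrow> ('a \<Rightarrow> 'a) set" where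
  "swaps F p q = {f \<in> F. f p = q \<and> f q = p}"

text \<open>The circles that touch the identity circle at \<open>(p, p)\<close>, with the identity
  included so that they can form a group.\<close>

definition tangents :: "'a set \<Rightarrow> ('a \<Rightarrow> 'a) set \<Rightarrow> 'a \<Rightarrow> ('a \<Rightarrow> 'a) set" where
  "tangents X F p = {f \<in> fix1 F p. f = id \<or> (\<forall>x\<in>X - {p}. f x \<noteq> x)}"

text \<open>The circles through \<open>(p, p)\<close> that are orthogonal to the identity
  circle.\<close>

definition involutions :: "('a \<Rightarrow> 'a) set \<Rightarrow> 'a \<Rightarrow> ('a \<Rightarrow> 'a) set" where
  "involutions F p = {f \<in> fix1 F p. f \<noteq> id \<and> (\<forall>x. f (f x) = x)}"

text \<open>Replaces the circle that plays the role of the identity by \<open>f\<close>.\<close>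

definition rebase :: "('a \<Rightarrow> 'a) \<Rightarrow> ('a \<Rightarrow> 'a) set \<Rightarrow> ('a \<Rightarrow> 'a) set" where
  "rebase f F = (\<circ>) (inv f) ` F"

definition touching :: "'a set \<Rightarrow> 'a \<Rightarrow> ('a \<Rightarrow> 'b) \<Rightarrow> ('a \<Rightarrow> 'b) \<Rightarrow> bool" where
  "touching X p f g \<longleftrightarrow> f = g \<or> (\<forall>x\<in>X - {p}. f x \<noteq> g x)"

text \<open>The circles of a symmetric Minkowski plane, read as permutations of a fixed circle, which
  itself becomes the identity.\<close>

locale symmetric_permutations =
  fixes X :: "'a set" and F :: "('a \<Rightarrow> 'a) set"
  assumes perm: "f \<in> F \<Longrightarrow> f permutes X"
    and fourth: "\<exists>d\<in>X. d \<noteq> a \<and> d \<noteq> b \<and> d \<noteq> c"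
    and trans3: "a \<in> X \<Longrightarrow> b \<in> X \<Longrightarrow> c \<in> X \<Longrightarrow> a \<noteq> b \<Longrightarrow> a \<noteq> c \<Longrightarrow> b \<noteq> c \<Longrightarrow>
      a' \<in> X \<Longrightarrow> b' \<in> X \<Longrightarrow> c' \<in> X \<Longrightarrow> a' \<noteq> b' \<Longrightarrow> a' \<noteq> c' \<Longrightarrow> b' \<noteq> c' \<Longrightarrow>
      \<exists>f\<in>F. f a = a' \<and> f b = b' \<and> f c = c'"
    and unique3: "f \<in> F \<Longrightarrow> g \<in> F \<Longrightarrow> a \<in> X \<Longrightarrow> b \<in> X \<Longrightarrow> c \<in> X \<Longrightarrow>
      a \<noteq> b \<Longrightarrow> a \<noteq> c \<Longrightarrow> b \<noteq> c \<Longrightarrow> f a = g a \<Longrightarrow> f b = g b \<Longrightarrow> f c = g c \<Longrightarrow> f = g"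
    and symmetry: "f \<in> F \<Longrightarrow> g \<in> F \<Longrightarrow> x \<in> X \<Longrightarrow> z \<in> X \<Longrightarrow> x \<noteq> z \<Longrightarrow>
      f z = g x \<Longrightarrow> g z = f x \<Longrightarrow> y \<in> X \<Longrightarrow> w \<in> X \<Longrightarrow> f w = g y \<Longrightarrow> g w = f y"
    and id_mem: "id \<in> F"
begin

lemma mem_iff [simp]: "f \<in> F \<Longrightarrow> f x \<in> X \<longleftrightarrow> x \<in> X"
  using perm permutes_in_image by metis

lemma inj_iff [simp]: "f \<in> F \<Longrightarrow> f x = f y \<longleftrightarrow> x = y"
  using perm permutes_inj by (metis injD)

lemma outside: "f \<in> F \<Longrightarrow> x \<notin> X \<Longrightarrow> f x = x"
  using perm permutes_not_in by metis

lemma inv_f [simp]: "f \<in> F \<Longrightarrow> inv f (f x) = x" "f \<in> F \<Longrightarrow> f (inv f x) = x"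
  using perm permutes_inverses by metis+

lemma inv_in [simp]: "f \<in> F \<Longrightarrow> inv f x \<in> X \<longleftrightarrow> x \<in> X"
  by (metis inv_f(2) mem_iff)

lemma bij: "f \<in> F \<Longrightarrow> bij f"
  using perm permutes_bij by metis

lemma inv_inv [simp]: "f \<in> F \<Longrightarrow> inv (inv f) = f"
  using bij inv_inv_eq by metis

text \<open>The symmetry axiom with the identity as one of the two circles: a single 2-cycle forces
  an involution.\<close>

lemma involution:
  assumes "j \<in> F" "j x = z" "j z = x" "x \<noteq> z"
  shows "j (j y) = y"
proof (cases "y \<in> X")
  case True
  have "x \<in> X" using assms outside by metis
  then show ?thesis
    using symmetry[OF id_mem assms(1), of x z y "j y"] assms True
    by (metis id_apply mem_iff)
next
  case False
  then show ?thesis using assms outside by metis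
qed

text \<open>The symmetry axiom for \<open>j\<close> and \<open>t\<close>: by hypothesis
  \<open>j \<circ> t\<close> exchanges \<open>x\<close> and \<open>z\<close>, so it is an
  involution.\<close>

lemma inverts:
  assumes "j \<in> F" "\<And>y. j (j y) = y" "t \<in> F" "j z = t x" "t z = j x" "x \<noteq> z" "x \<in> X"
  shows "t (j (t y)) = j y"
proof (cases "y \<in> X")
  case True
  have "z \<in> X" using assms by (metis mem_iff)
  then show ?thesis
    using symmetry[OF assms(1,3), of x z y "j (t y)"] assms True by simp
next
  case False
  then show ?thesis using assms outside by metis
qed

lemma swap_ex:
  assumes "a \<in> X" "b \<in> X" "c \<in> X" "d \<in> X" "a \<noteq> b" "c \<noteq> a" "c \<noteq> b" "d \<noteq> a" "d \<noteq> b"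
  obtains j where "j \<in> F" "j a = b" "j b = a" "j c = d" "\<And>y. j (j y) = y"
proof -
  obtain j where "j \<in> F" "j a = b" "j b = a" "j c = d"
    using trans3[of a b c b a d] assms by metis
  then show ?thesis using that involution assms(5) by blast
qed

text \<open>Composing all members with \<open>inv f\<close> preserves coincidences of their values,
  hence the axioms, and turns \<open>f\<close> into the identity. Results about the identity thus
  hold relative to any circle.\<close>

lemma base_change:
  assumes "f \<in> F"
  shows "symmetric_permutations X (rebase f F)"
  unfolding rebase_def
proof
  show "g permutes X" if "g \<in> (\<circ>) (inv f) ` F" for g
    using that assms perm by (auto intro!: permutes_compose permutes_inv)
  show "\<exists>d\<in>X. d \<noteq> a \<and> d \<noteq> b \<and> d \<noteq> c" for a b c by (rule fourth)
next
  fix a b c a' b' c'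
  assume *: "a \<in> X" "b \<in> X" "c \<in> X" "a \<noteq> b" "a \<noteq> c" "b \<noteq> c"
    "a' \<in> X" "b' \<in> X" "c' \<in> X" "a' \<noteq> b'" "a' \<noteq> c'" "b' \<noteq> c'"
  obtain g where "g \<in> F" "g a = f a'" "g b = f b'" "g c = f c'"
    using trans3[OF *(1-6), of "f a'" "f b'" "f c'"] assms * by auto
  then show "\<exists>g\<in>(\<circ>) (inv f) ` F. g a = a' \<and> g b = b' \<and> g c = c'"
    using assms by (intro bexI[of _ "inv f \<circ> g"]) auto
next
  have inj: "inv f x = inv f y \<longleftrightarrow> x = y" for x y using assms by (metis inv_f(2))
  show "g = h" if gh: "g \<in> (\<circ>) (inv f) ` F" "h \<in> (\<circ>) (inv f) ` F"
    and abc: "a \<in> X" "b \<in> X" "c \<in> X" "a \<noteq> b" "a \<noteq> c" "b \<noteq> c"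
    and eq: "g a = h a" "g b = h b" "g c = h c" for g h a b c
  proof -
    obtain g' h' where *: "g' \<in> F" "h' \<in> F" "g = inv f \<circ> g'" "h = inv f \<circ> h'"
      using gh by blast
    have "g' = h'" by (rule unique3[OF *(1,2) abc]) (use eq * inj in simp_all)
    then show ?thesis using * by simp
  qed
  show "g w = h y" if gh: "h \<in> (\<circ>) (inv f) ` F" "g \<in> (\<circ>) (inv f) ` F"
    and xz: "x \<in> X" "z \<in> X" "x \<noteq> z" and eq: "h z = g x" "g z = h x"
    and yw: "y \<in> X" "w \<in> X" "h w = g y" for g h x z y w
  proof -
    obtain g' h' where *: "g' \<in> F" "h' \<in> F" "g = inv f \<circ> g'" "h = inv f \<circ> h'"
      using gh by blast
    have "g' w = h' y"
      by (rule symmetry[OF *(2,1) xz _ _ yw(1,2)]) (use eq yw * inj in simp_all)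
    then show ?thesis using * by simp
  qed
  show "id \<in> (\<circ>) (inv f) ` F"
    using assms by (intro image_eqI[of _ _ f]) auto
qed

section \<open>Members with two given fixed points\<close>

text \<open>If \<open>t\<close> fixes \<open>p\<close> and \<open>q\<close> while \<open>j\<close>
  exchanges them, then \<open>j \<circ> t\<close> exchanges them as well, so \<open>inverts\<close>
  applies.\<close>

lemma inverted_family_fix2:
  assumes "p \<in> X" "q \<in> X" "p \<noteq> q"
  shows "inverted_family (X - {p, q}) (fix2 F p q) (swaps F p q)"
proof
  show "t permutes X - {p, q}" if "t \<in> fix2 F p q" for t
    using that perm by (auto simp: fix2_def intro: permutes_superset)
  show "X - {p, q} \<noteq> {}" using fourth[of p q q] by auto
  show "\<exists>t\<in>fix2 F p q. t u = v" if "u \<in> X - {p, q}" "v \<in> X - {p, q}" for u v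
    using that assms trans3[of p q u p q v] by (auto simp: fix2_def)
  show inv: "j (j x) = x" if "j \<in> swaps F p q" for j x
    using that assms involution[of j p q] by (auto simp: swaps_def)
  show "t (j (t x)) = j x" if "t \<in> fix2 F p q" "j \<in> swaps F p q" for t j x
    using that assms inverts[of j t q p] inv[of j] by (auto simp: fix2_def swaps_def)
  show "\<exists>j\<in>swaps F p q. j u = v" if "u \<in> X - {p, q}" "v \<in> X - {p, q}" for u v
    using that assms trans3[of p q u q p v] by (auto simp: swaps_def)
qed

text \<open>If \<open>t \<noteq> i\<close>, the member \<open>k\<close> that swaps \<open>p\<close>
  and \<open>q\<close> and has \<open>k u = i u\<close> agrees with \<open>i\<close> at the three
  points \<open>u\<close>, \<open>i u\<close>, \<open>t u\<close>, although it moves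
  \<open>p\<close>.\<close>

lemma involution_fix2_unique:
  assumes "p \<in> X" "q \<in> X" "p \<noteq> q" "i \<in> fix2 F p q" "t \<in> fix2 F p q" "i \<noteq> id" "t \<noteq> id"
    and ii: "\<And>x. i (i x) = x" and tt: "\<And>x. t (t x) = x"
  shows "t = i"
proof (rule ccontr)
  assume "t \<noteq> i"
  interpret M: inverted_family "X - {p, q}" "fix2 F p q" "swaps F p q"
    by (rule inverted_family_fix2) fact+
  obtain u where u: "u \<in> X - {p, q}" using M.nonempty by blast
  have F: "i \<in> F" "t \<in> F" "i p = p" "i q = q" "t p = p" "t q = q"
    using assms by (auto simp: fix2_def)
  have "i u \<noteq> u" "t u \<noteq> u" "t u \<noteq> i u"
    using unique3[of i id p q u] unique3[of t id p q u] unique3[of t i p q u] u assms F id_mem \<open>t \<noteq> i\<close>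
    by auto
  moreover have "i u \<in> X - {p, q}"
    using u M.perm[of i] assms by (metis permutes_in_image)
  moreover obtain k where k: "k \<in> swaps F p q" "k u = i u"
    using M.moves[of u "i u"] u calculation by metis
  moreover have kt: "k (t u) = i (t u)"
    using M.inverts[of t k u] M.commute[of t i u] tt assms k by metis
  moreover have "k (i u) = i (i u)" using k M.invol ii by metis
  moreover have kF: "k \<in> F" "k p = q" using k by (auto simp: swaps_def)
  ultimately have "k = i"
    using unique3[of k i u "i u" "t u"] F u by auto
  then show False using kF F assms by simp
qed

section \<open>Members tangent to the identity at a point\<close>

context
  fixes p assumes p: "p \<in> X"
begin

lemma involutions_ex:
  assumes "u \<in> X - {p}" "v \<in> X - {p}" "u \<noteq> v"
  shows "\<exists>j\<in>involutions F p. j u = v"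
proof -
  obtain j where "j \<in> F" "j u = v" "j v = u" "j p = p" "\<And>y. j (j y) = y"
    using swap_ex[of u v p p] assms p by auto
  then show ?thesis using assms by (intro bexI[of _ j]) (auto simp: involutions_def fix1_def)
qed

text \<open>The involution \<open>j'\<close> swaps \<open>u\<close> and \<open>v = j u\<close>, and
  \<open>j' (t u) = inv t v\<close> makes the axiom applicable to \<open>t\<close> and
  \<open>j'\<close>. It follows that \<open>t\<close> fixes \<open>j' p\<close>; since
  \<open>p\<close> is the only fixed point of \<open>t\<close>, \<open>j' p = p\<close> and
  \<open>j' = j\<close>.\<close>

lemma tangents_inverted:
  assumes "t \<in> tangents X F p" "j \<in> involutions F p"
  shows "t (j (t x)) = j x"
proof -
  have F: "t \<in> F" "j \<in> F" "t p = p" "j p = p" "\<And>x. j (j x) = x" "j \<noteq> id"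
    using assms by (auto simp: tangents_def fix1_def involutions_def fix1_def)
  consider "t = id" | "t = j" | "t \<noteq> id" "t \<noteq> j" by blast
  then show ?thesis
  proof cases
    case 3
    have nofix: "t x \<noteq> x" if "x \<in> X - {p}" for x
      using assms 3 that by (auto simp: tangents_def fix1_def)
    obtain u0 where u0: "j u0 \<noteq> u0" using F(6) by (metis eq_id_iff)
    have "u0 \<in> X - {p}" using u0 F outside by auto
    then have u0': "u0 \<in> X" "u0 \<noteq> p" "j u0 \<in> X" "j u0 \<noteq> p" using F by (metis Diff_iff inj_iff mem_iff singleton_iff)+
    \<comment> \<open>Agreement of \<open>t\<close> and \<open>j\<close> at \<open>p\<close>,
      \<open>u0\<close> and \<open>j u0\<close> would give \<open>t = j\<close>, so one of
      \<open>u0\<close>, \<open>j u0\<close> serves as \<open>u\<close>.\<close>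
    have "\<not> (j u0 = t u0 \<and> t (j u0) = u0)"
    proof
      assume a: "j u0 = t u0 \<and> t (j u0) = u0"
      have "t p = j p" "t u0 = j u0" "t (j u0) = j (j u0)" using a F(3-5) by metis+
      then have "t = j" by (intro unique3[OF F(1,2) p u0'(1,3)]) (use u0 u0'(2,4) in auto)
      then show False using 3 by blast
    qed
    then consider "j u0 \<noteq> t u0" | "j (j u0) \<noteq> t (j u0)" using F(5) by metis
    then obtain u where u: "u \<in> X - {p}" "j u \<noteq> u" "j u \<noteq> t u"
    proof cases
      case 1
      then show ?thesis using u0 u0' by (intro that[of u0]) auto
    next
      case 2
      then show ?thesis using u0 u0' F(5)[of u0] by (intro that[of "j u0"]) auto
    qed
    define v where "v = j u"
    have v: "v \<in> X - {p}" using u F unfolding v_def by (metis Diff_iff inj_iff mem_iff singleton_iff)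
    have "inv t v \<noteq> u" "inv t v \<noteq> v" "inv t v \<in> X" "t u \<noteq> u" "t u \<noteq> v"
      using u v nofix F unfolding v_def by (metis Diff_iff inv_f(2) mem_iff)+
    then obtain j' where j': "j' \<in> F" "j' u = v" "j' v = u" "j' (t u) = inv t v" "\<And>y. j' (j' y) = y"
      using swap_ex[of u v "t u" "inv t v"] u v F unfolding v_def by (metis DiffE mem_iff)
    have "j' (inv t v) = t u" "t (inv t v) = j' u" using j' F(1) by (metis inv_f(2))+
    then have tj': "t (j' (t y)) = j' y" for y
      using \<open>inv t v \<noteq> u\<close> u(1) by (intro inverts[OF j'(1,5) F(1), where x = u and z = "inv t v"]) auto
    have "t (j' p) = j' p" using tj'[of p] F by simp
    moreover have "j' p \<in> X" using j' p by simp
    ultimately have "j' p = p" using nofix by auto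
    then have "j' = j"
      using unique3[of j' j p u v] j' F u v p unfolding v_def by auto
    then show ?thesis using tj' by simp
  qed (use F in auto)
qed

text \<open>The values of \<open>t\<close> are chosen so that the involution \<open>i\<close>
  inverts it. A second fixed point of \<open>t\<close> would be fixed by \<open>i\<close> too; then
  \<open>t\<close> and \<open>i\<close> commute, \<open>t\<close> is an involution, and
  \<open>involution_fix2_unique\<close> gives \<open>t = i\<close>, against
  \<open>i u \<noteq> v\<close>.\<close>

lemma tangents_trans:
  assumes "u \<in> X - {p}" "v \<in> X - {p}"
  shows "\<exists>t\<in>tangents X F p. t u = v"
proof (cases "u = v")
  case True
  then show ?thesis using id_mem by (auto simp: tangents_def fix1_def)
next
  case False
  \<comment> \<open>The choice \<open>w \<noteq> u\<close> is what yields
    \<open>i u \<noteq> v\<close>.\<close>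
  obtain w where w: "w \<in> X" "w \<noteq> p" "w \<noteq> u" "w \<noteq> v" using fourth by blast
  then obtain i where i: "i \<in> involutions F p" "i v = w" using involutions_ex[of v w] assms by auto
  have F: "i \<in> F" "i p = p" "\<And>x. i (i x) = x" "i \<noteq> id" using i by (auto simp: involutions_def fix1_def)
  have ne: "i v \<noteq> u" "i u \<noteq> v" "i v \<noteq> p" "i u \<noteq> p" using i F w assms by (metis Diff_iff insertI1)+
  obtain t where t: "t \<in> F" "t p = p" "t u = v" "t (i v) = i u"
    using trans3[of p u "i v" p v "i u"] assms ne F p False by (metis DiffD1 DiffD2 mem_iff singletonI)
  have tit: "t (i (t y)) = i y" for y
    by (rule inverts[of i t "i v" u]) (use t F ne assms in auto)
  have "t w' \<noteq> w'" if w': "w' \<in> X - {p}" for w'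
  proof
    assume fx: "t w' = w'"
    have tn: "t \<noteq> id" using t False by auto
    have "t (i w') = i w'" using tit[of w'] fx by simp
    moreover have "i w' \<in> X" "i w' \<noteq> p" using w' F by (metis Diff_iff mem_iff singleton_iff)+
    ultimately have "i w' = w'"
      using unique3[of t id p w' "i w'"] fx t tn w' p id_mem by auto
    then have M: "i \<in> fix2 F p w'" "t \<in> fix2 F p w'" using F t fx by (auto simp: fix2_def)
    interpret M: inverted_family "X - {p, w'}" "fix2 F p w'" "swaps F p w'"
      by (rule inverted_family_fix2) (use p w' in auto)
    have "t (t x) = x" for x using M.commute[OF M] tit F by metis
    then have "t = i" using involution_fix2_unique[of p w' i t] M w' p F tn by auto
    then show False using t ne by simp
  qed
  then show ?thesis using t by (intro bexI[of _ t]) (auto simp: tangents_def fix1_def)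
qed

lemma inverted_family_tangents: "inverted_family (X - {p}) (tangents X F p) (involutions F p)"
proof
  show "t permutes X - {p}" if "t \<in> tangents X F p" for t
    using that perm by (auto simp: tangents_def fix1_def intro: permutes_superset)
  show "X - {p} \<noteq> {}" using fourth[of p p p] by auto
qed (use tangents_trans tangents_inverted involutions_ex in \<open>auto simp: involutions_def fix1_def\<close>)

interpretation N: inverted_family "X - {p}" "tangents X F p" "involutions F p"
  by (rule inverted_family_tangents)

lemma fix1_cases:
  assumes "f \<in> fix1 F p"
  obtains "f \<in> tangents X F p" | q where "q \<in> X" "q \<noteq> p" "f \<in> fix2 F p q"
  using assms by (auto simp: fix1_def fix2_def tangents_def fix1_def)

text \<open>A member that fixes \<open>p\<close> is a tangent or has a second fixed point
  \<open>q\<close>; both \<open>tangents X F p\<close> and \<open>fix2 F p q\<close> are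
  groups.\<close>

lemma inv_fix1:
  assumes "f \<in> fix1 F p"
  shows "inv f \<in> fix1 F p"
  using assms
proof (cases rule: fix1_cases)
  case 1
  then show ?thesis using N.inv_closed by (auto simp: tangents_def fix1_def)
next
  case (2 q)
  then interpret M: inverted_family "X - {p, q}" "fix2 F p q" "swaps F p q"
    by (intro inverted_family_fix2) (use p in auto)
  show ?thesis using M.inv_closed 2 by (auto simp: fix2_def fix1_def)
qed

text \<open>This is \<open>inv_fix1\<close> with \<open>f\<close> as the identity: the inverse of
  \<open>inv f \<circ> g\<close> is
  \<open>inv f \<circ> (f \<circ> inv g \<circ> f)\<close>.\<close>

lemma reflect_fix1:
  assumes "f \<in> fix1 F p" "g \<in> fix1 F p"
  shows "f \<circ> inv g \<circ> f \<in> fix1 F p"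
proof -
  have F: "f \<in> F" "g \<in> F" "f p = p" "g p = p" using assms by (auto simp: fix1_def)
  interpret B: symmetric_permutations X "rebase f F" by (rule base_change) fact
  have "inv f p = p" using F by (metis inv_f(1))
  then have "inv f \<circ> g \<in> fix1 (rebase f F) p"
    using F by (auto simp: fix1_def rebase_def)
  then have "inv (inv f \<circ> g) \<in> fix1 (rebase f F) p" by (rule B.inv_fix1[OF p])
  moreover have "inv (inv f \<circ> g) = inv g \<circ> f"
    using o_inv_distrib[OF bij_imp_bij_inv[OF bij[OF F(1)]] bij[OF F(2)]] F by simp
  ultimately obtain h where h: "h \<in> F" "inv g \<circ> f = inv f \<circ> h"
    by (auto simp: fix1_def rebase_def)
  have "f \<circ> inv g \<circ> f = h"
  proof
    fix x
    show "(f \<circ> inv g \<circ> f) x = h x"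
      using fun_cong[OF h(2), of x] F(1) by simp
  qed
  moreover have "(f \<circ> inv g \<circ> f) p = p" using F by simp (metis inv_f(1))
  ultimately show ?thesis using h(1) by (simp add: fix1_def)
qed

section \<open>Tangency as an equivalence relation\<close>

lemma touching_rebase:
  assumes "f \<in> fix1 F p" "g \<in> fix1 F p" "touching X p f g"
  shows "inv f \<circ> g \<in> tangents X (rebase f F) p"
proof -
  have F: "f \<in> F" "g \<in> F" "f p = p" "g p = p" using assms by (auto simp: fix1_def)
  have "inv f p = p" using F by (metis inv_f(1))
  have "inv f \<circ> g = id \<or> (\<forall>x\<in>X - {p}. (inv f \<circ> g) x \<noteq> x)"
    using assms(3) unfolding touching_def
  proof
    assume "f = g"
    then show ?thesis using F by auto
  next
    assume "\<forall>x\<in>X - {p}. f x \<noteq> g x"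
    then show ?thesis using F by (metis comp_apply inv_f(2))
  qed
  then show ?thesis
    using F \<open>inv f p = p\<close> by (simp add: tangents_def fix1_def rebase_def)
qed

lemma touching_sym: "touching X p f g \<Longrightarrow> touching X p g f"
  unfolding touching_def by metis

text \<open>With \<open>g\<close> as the identity, \<open>f\<close> and \<open>h\<close> become
  tangents, and these form a group.\<close>

lemma touching_trans:
  assumes "f \<in> fix1 F p" "g \<in> fix1 F p" "h \<in> fix1 F p" "touching X p f g" "touching X p g h"
  shows "touching X p f h"
proof -
  have F: "f \<in> F" "g \<in> F" "h \<in> F" using assms by (auto simp: fix1_def)
  interpret B: symmetric_permutations X "rebase g F" by (rule base_change) fact
  interpret BN: inverted_family "X - {p}" "tangents X (rebase g F) p" "involutions (rebase g F) p"
    by (rule B.inverted_family_tangents[OF p])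
  let ?a = "inv g \<circ> f" and ?b = "inv g \<circ> h"
  have ab: "?a \<in> tangents X (rebase g F) p" "?b \<in> tangents X (rebase g F) p"
    using touching_rebase assms touching_sym by blast+
  then have *: "inv ?a \<circ> ?b \<in> tangents X (rebase g F) p"
    using BN.inv_closed BN.comp_closed by blast
  have a: "?a permutes X - {p}" using ab BN.perm by blast
  show ?thesis
  proof (cases "inv ?a \<circ> ?b = id")
    case True
    then have "?a = ?b" using a by (metis comp_assoc comp_id id_comp permutes_inv_o(1))
    then have "f = h" using F by (metis fun.map_comp fun.map_id0 comp_assoc id_comp permutes_inv_o(1) perm)
    then show ?thesis by (simp add: touching_def)
  next
    case False
    have "f x \<noteq> h x" if x: "x \<in> X - {p}" for x
    proof
      assume "f x = h x"
      then have "(inv ?a \<circ> ?b) x = x" using permutes_inverses(2)[OF a, of x] by simp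
      then show False using * False x by (auto simp: tangents_def)
    qed
    then show ?thesis by (auto simp: touching_def)
  qed
qed

lemma touching_eq:
  assumes "touching X p f g" "x \<in> X - {p}" "f x = g x"
  shows "f = g"
  using assms by (auto simp: touching_def)

section \<open>Orthogonal classes and translations\<close>

text \<open>Let the involution \<open>j'\<close> agree with \<open>j \<circ> t\<close> at one moved
  point. Both \<open>j\<close> and \<open>j'\<close> invert all tangents, so
  \<open>j \<circ> j'\<close> commutes with them and equals \<open>t\<close> by
  \<open>eq_if_commute\<close>.\<close>

lemma involution_comp:
  assumes "j \<in> involutions F p" "t \<in> tangents X F p"
  shows "j \<circ> t \<in> fix1 F p"
proof (cases "j \<circ> t = id")
  case True
  then show ?thesis using id_mem by (simp add: fix1_def)
next
  case False
  have J: "j \<in> F" "j p = p" "\<And>x. j (j x) = x" using assms by (auto simp: involutions_def fix1_def)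
  have jt: "j \<circ> t permutes X - {p}"
    by (rule permutes_compose[OF N.perm]) (use assms J perm in \<open>auto intro: permutes_superset\<close>)
  obtain u where u: "(j \<circ> t) u \<noteq> u" using False by (metis eq_id_iff)
  then have uX: "u \<in> X - {p}" "(j \<circ> t) u \<in> X - {p}"
    using jt by (metis permutes_not_in permutes_in_image)+
  then obtain j' where j': "j' \<in> involutions F p" "j' u = (j \<circ> t) u"
    using involutions_ex u by metis
  have J': "j' \<in> F" "j' p = p" "\<And>x. j' (j' x) = x" using j' by (auto simp: involutions_def fix1_def)
  have "j \<circ> j' = t"
  proof (rule N.eq_if_commute[OF _ N.perm[OF assms(2)] uX(1)])
    show "j \<circ> j' permutes X - {p}"
      by (rule permutes_compose) (use J J' perm in \<open>auto intro: permutes_superset\<close>)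
    show "(j \<circ> j') u = t u" using j' J by simp
    show "(j \<circ> j') (s x) = s ((j \<circ> j') x)" if "s \<in> tangents X F p" for s x
      using N.inverts[OF that assms(1)] N.inverts[OF that j'(1)] by (metis comp_apply)
    show "t (s x) = s (t x)" if "s \<in> tangents X F p" for s x
      using N.commute assms that by blast
  qed
  then have "j \<circ> t = j'" using J by auto
  then show ?thesis using J' by (simp add: fix1_def)
qed

text \<open>For a fixed involution \<open>j\<close>, the members touching
  \<open>c = j \<circ> t\<close> are of the form \<open>j \<circ> s\<close> with \<open>s\<close> a
  tangent, and \<open>n (j (s (n x))) = n (j (n (s x))) = j (s x)\<close>.\<close>

lemma orthogonal_class:
  assumes "u \<in> X - {p}" "v \<in> X - {p}"
  obtains c where "c \<in> fix1 F p" "c u = v" "u \<noteq> v \<Longrightarrow> c \<in> involutions F p"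
    "\<And>e n. e \<in> fix1 F p \<Longrightarrow> touching X p e c \<Longrightarrow> n \<in> tangents X F p \<Longrightarrow> n \<circ> e \<circ> n = e"
proof -
  obtain w where "w \<in> X - {p}" "w \<noteq> u" using fourth[of p u u] by blast
  then obtain j where j: "j \<in> involutions F p" using involutions_ex assms by blast
  have J: "j \<in> F" "j p = p" "\<And>x. j (j x) = x" using j by (auto simp: involutions_def fix1_def)
  have jX: "j x \<in> X - {p}" if "x \<in> X - {p}" for x using that J by (metis Diff_iff mem_iff singleton_iff)
  obtain t where t: "t \<in> tangents X F p" "t u = j v" using N.trans[of u "j v"] assms jX by auto
  show ?thesis
  proof (rule that)
    show "j \<circ> t \<in> fix1 F p" using involution_comp j t by blast
    show "(j \<circ> t) u = v" using J t by simp
    show "j \<circ> t \<in> involutions F p" if "u \<noteq> v"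
    proof -
      have "(j \<circ> t) u = v" using J t by simp
      then have "j \<circ> t \<noteq> id" using that by (metis id_apply)
      then show ?thesis
        using involution_comp[OF j t(1)] J N.inverts[OF t(1) j] by (simp add: involutions_def)
    qed
    show "n \<circ> e \<circ> n = e" if e: "e \<in> fix1 F p" "touching X p e (j \<circ> t)" and n: "n \<in> tangents X F p" for e n
    proof -
      have "e u \<in> X - {p}" using e assms by (simp add: fix1_def) (metis inj_iff)
      then obtain s where s: "s \<in> tangents X F p" "s u = j (e u)" using N.trans[of u "j (e u)"] assms jX by auto
      have "touching X p (j \<circ> t) (j \<circ> s)"
      proof (cases "\<exists>x\<in>X - {p}. t x = s x")
        case True
        then obtain x where x: "x \<in> X - {p}" "t x = s x" by blast
        have "t = s"
          using N.commute t(1) s(1) by (intro N.eq_if_commute[OF N.perm[OF t(1)] N.perm[OF s(1)] x]) blast+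
        then show ?thesis by (simp add: touching_def)
      next
        case False
        then show ?thesis using J by (auto simp: touching_def)
      qed
      then have "touching X p e (j \<circ> s)"
        using touching_trans[OF e(1) involution_comp[OF j t(1)] involution_comp[OF j s(1)] e(2)] by blast
      then have "e = j \<circ> s" using touching_eq[of e "j \<circ> s" u] assms s J by simp
      then show ?thesis using N.commute[OF n s(1)] N.inverts[OF n j] by (auto simp: fun_eq_iff) metis
    qed
  qed
qed

text \<open>The map \<open>(x, y) \<mapsto> (n\<^sup>-\<^sup>1 x, n y)\<close> takes the circle \<open>g\<close> to \<open>n g n\<close>. It has no fixed point
  off the generators through \<open>(p, p)\<close>, and every circle of the class from \<open>orthogonal_class\<close>
  is invariant under it. So a common point of \<open>g\<close> and \<open>n g n\<close> gives two
  points that \<open>g\<close> shares with a circle of this class.\<close>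

lemma translate_touching:
  assumes "n \<in> tangents X F p" "g \<in> fix1 F p"
  shows "n \<circ> g \<circ> n \<in> fix1 F p" "touching X p (n \<circ> g \<circ> n) g"
proof -
  have F: "n \<in> F" "g \<in> F" "n p = p" "g p = p" "n \<in> fix1 F p"
    using assms by (auto simp: fix1_def tangents_def)
  have "n \<circ> inv (inv g) \<circ> n \<in> fix1 F p" using reflect_fix1 inv_fix1 F assms by blast
  then show "n \<circ> g \<circ> n \<in> fix1 F p" using F by simp
  show "touching X p (n \<circ> g \<circ> n) g"
  proof (cases "n = id \<or> (\<forall>x\<in>X - {p}. (n \<circ> g \<circ> n) x \<noteq> g x)")
    case True
    then show ?thesis by (auto simp: touching_def)
  next
    case False
    then obtain x where x: "x \<in> X - {p}" "n (g (n x)) = g x" by auto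
    have "g x \<in> X - {p}" using x F by (metis Diff_iff inj_iff mem_iff singleton_iff)
    then obtain c where c: "c \<in> fix1 F p" "c x = g x" "n \<circ> c \<circ> n = c"
      using orthogonal_class[OF x(1)] assms(1) by (metis touching_def)
    have "n (c (n x)) = n (g (n x))" using fun_cong[OF c(3), of x] c(2) x(2) by simp
    then have "c (n x) = g (n x)" using F by simp
    moreover have nx: "n x \<noteq> x" "n x \<noteq> p" "n x \<in> X" "x \<in> X" "x \<noteq> p"
      using False assms x F by (auto simp: tangents_def)
    moreover have "c \<in> F" "c p = g p" using c(1) F by (auto simp: fix1_def)
    ultimately have "c = g" using c(2) by (intro unique3[OF _ F(2) p nx(4,3)]) simp_all
    then show ?thesis using c by (simp add: touching_def)
  qed
qed

lemma rebase_fix1: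
  assumes "f \<in> fix1 F p"
  shows "fix1 (rebase f F) p = (\<circ>) (inv f) ` fix1 F p"
proof -
  have "f \<in> F" "f p = p" using assms by (auto simp: fix1_def)
  then have *: "inv f x = p \<longleftrightarrow> x = p" for x by (metis inv_f(1) inv_f(2))
  show ?thesis unfolding fix1_def rebase_def by (auto simp: *)
qed

lemma touching_comp:
  assumes "f \<in> F"
  shows "touching X p (f \<circ> g) h \<longleftrightarrow> touching X p g (inv f \<circ> h)"
proof -
  have "f (g x) = h x \<longleftrightarrow> g x = inv f (h x)" for x using assms by (metis inv_f)
  then show ?thesis unfolding touching_def fun_eq_iff comp_apply by simp
qed

text \<open>\<open>translate_touching\<close> with \<open>f\<close> as the identity, carried back by
  composing with \<open>f\<close>. The underlying map of points is now \<open>(x, y)\<close> to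
  \<open>(inv n x, f (n (inv f y)))\<close>.\<close>

lemma translate_touching_rebase:
  assumes "f \<in> fix1 F p" "n \<in> tangents X (rebase f F) p" "g \<in> fix1 F p"
  shows "f \<circ> n \<circ> inv f \<circ> g \<circ> n \<in> fix1 F p" "touching X p (f \<circ> n \<circ> inv f \<circ> g \<circ> n) g"
proof -
  have F: "f \<in> F" "f p = p" using assms by (auto simp: fix1_def)
  interpret B: symmetric_permutations X "rebase f F" by (rule base_change) fact
  have g: "inv f \<circ> g \<in> fix1 (rebase f F) p" using assms rebase_fix1 by blast
  note T = B.translate_touching[OF p assms(2) g]
  obtain h where h: "h \<in> fix1 F p" "n \<circ> (inv f \<circ> g) \<circ> n = inv f \<circ> h"
    using T(1) rebase_fix1[OF assms(1)] by blast
  have "f \<circ> (n \<circ> (inv f \<circ> g) \<circ> n) = h" unfolding h(2) using F by auto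
  then show "f \<circ> n \<circ> inv f \<circ> g \<circ> n \<in> fix1 F p" using h(1) by (simp add: comp_assoc)
  show "touching X p (f \<circ> n \<circ> inv f \<circ> g \<circ> n) g"
    using T(2) touching_comp[OF F(1), of "n \<circ> (inv f \<circ> g) \<circ> n" g] by (simp add: comp_assoc)
qed

lemma orthogonal_class_rebase:
  assumes "f \<in> fix1 F p" "u \<in> X - {p}" "v \<in> X - {p}"
  obtains d where "d \<in> fix1 F p" "d u = v" "f u \<noteq> v \<Longrightarrow> inv f \<circ> d \<in> involutions (rebase f F) p"
    "\<And>e n. e \<in> fix1 F p \<Longrightarrow> touching X p e d \<Longrightarrow> n \<in> tangents X (rebase f F) p \<Longrightarrow>
      f \<circ> n \<circ> inv f \<circ> e \<circ> n = e"
proof -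
  have F: "f \<in> F" "f p = p" using assms by (auto simp: fix1_def)
  interpret B: symmetric_permutations X "rebase f F" by (rule base_change) fact
  have "inv f v \<in> X - {p}" using F assms by (metis Diff_iff inv_f(2) inv_in singleton_iff)
  then obtain c where c: "c \<in> fix1 (rebase f F) p" "c u = inv f v"
    "u \<noteq> inv f v \<Longrightarrow> c \<in> involutions (rebase f F) p"
    "\<And>e n. e \<in> fix1 (rebase f F) p \<Longrightarrow> touching X p e c \<Longrightarrow> n \<in> tangents X (rebase f F) p \<Longrightarrow> n \<circ> e \<circ> n = e"
    using B.orthogonal_class[OF p assms(2)] by blast
  obtain d where d: "d \<in> fix1 F p" "c = inv f \<circ> d" using c(1) rebase_fix1[OF assms(1)] by blast
  show ?thesis
  proof (rule that)
    show "d u = v" using c(2) d F by simp (metis inv_f(2))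
    show "inv f \<circ> d \<in> involutions (rebase f F) p" if "f u \<noteq> v"
      using that c(3) d F by (metis inv_f(2))
    show "f \<circ> n \<circ> inv f \<circ> e \<circ> n = e"
      if e: "e \<in> fix1 F p" "touching X p e d" and n: "n \<in> tangents X (rebase f F) p" for e n
    proof -
      have eq: "f \<circ> (inv f \<circ> e) = e" using F by auto
      have "touching X p (inv f \<circ> e) c"
        using touching_comp[OF F(1), of "inv f \<circ> e" d] e(2) eq d by simp
      moreover have "inv f \<circ> e \<in> fix1 (rebase f F) p" using e(1) rebase_fix1[OF assms(1)] by blast
      ultimately have "n \<circ> (inv f \<circ> e) \<circ> n = inv f \<circ> e" using c(4) n by blast
      then have "f \<circ> (n \<circ> (inv f \<circ> e) \<circ> n) = e" using eq by simp
      then show ?thesis by (simp add: comp_assoc)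
    qed
  qed (rule d)
qed

text \<open>Two translations in different directions of an affine plane commute. The orthogonal
  classes of the identity and of \<open>f\<close> are different directions unless \<open>f\<close> is tangent to
  the identity.\<close>

lemma tangents_commute:
  assumes f: "f \<in> fix1 F p" "f \<notin> tangents X F p"
    and n: "n \<in> tangents X F p" and m: "m \<in> tangents X (rebase f F) p"
  shows "m (n z) = n (m z)"
proof (rule ccontr)
  assume ne: "m (n z) \<noteq> n (m z)"
  have F: "f \<in> F" "f p = p" "n \<in> F" "n p = p" using f n by (auto simp: fix1_def tangents_def)
  interpret B: symmetric_permutations X "rebase f F" by (rule base_change) fact
  have mF: "m \<in> rebase f F" "m p = p" using m by (auto simp: fix1_def tangents_def)
  have z: "z \<in> X - {p}"
    using ne F mF outside B.outside by (metis DiffI singletonD)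
  define x where "x = m (n z)"
  have xX: "x \<in> X - {p}"
    using z F mF unfolding x_def by (metis B.inj_iff B.mem_iff Diff_iff inj_iff mem_iff singleton_iff)
  \<comment> \<open>Avoiding \<open>x\<close> and \<open>f x\<close> makes \<open>c\<close> and
    \<open>inv f \<circ> d\<close> genuine involutions; \<open>y \<noteq> f x\<close> also gives the
    final contradiction.\<close>
  obtain y where y: "y \<in> X - {p}" "y \<noteq> x" "y \<noteq> f x" using fourth[of p x "f x"] by blast
  obtain c where c: "c \<in> fix1 F p" "c x = y" "c \<in> involutions F p"
    "\<And>e. e \<in> fix1 F p \<Longrightarrow> touching X p e c \<Longrightarrow> n \<circ> e \<circ> n = e"
    using orthogonal_class[OF xX y(1)] y(2) n by metis
  obtain d where d: "d \<in> fix1 F p" "d x = y" "inv f \<circ> d \<in> involutions (rebase f F) p"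
    "\<And>e. e \<in> fix1 F p \<Longrightarrow> touching X p e d \<Longrightarrow> f \<circ> m \<circ> inv f \<circ> e \<circ> m = e"
    using orthogonal_class_rebase[OF f(1) xX y(1)] y(3) m by metis
  \<comment> \<open>\<open>sc\<close> is the image of \<open>c\<close> under the translation of
    \<open>m\<close>, \<open>td\<close> that of \<open>d\<close> under the translation of
    \<open>n\<close>. Each stays in its class, so \<open>c\<close>, \<open>sc\<close> are invariant
    under \<open>n\<close> and \<open>d\<close>, \<open>td\<close> under \<open>m\<close>.\<close>
  define sc where "sc = f \<circ> m \<circ> inv f \<circ> c \<circ> m"
  define td where "td = n \<circ> d \<circ> n"
  have sc: "sc \<in> fix1 F p" "touching X p sc c"
    unfolding sc_def using translate_touching_rebase f m c(1) by blast+
  have td: "td \<in> fix1 F p" "touching X p td d"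
    unfolding td_def using translate_touching n d(1) by blast+
  have refl: "touching X p e e" for e :: "'a \<Rightarrow> 'a" by (simp add: touching_def)
  have fixc: "n (c (n w)) = c w" "n (sc (n w)) = sc w" for w
    using fun_cong[OF c(4)[OF c(1) refl], of w] fun_cong[OF c(4)[OF sc], of w] by auto
  have fixd: "f (m (inv f (d (m w)))) = d w" "f (m (inv f (td (m w)))) = td w" for w
    using fun_cong[OF d(4)[OF d(1) refl], of w] fun_cong[OF d(4)[OF td], of w] by auto
  \<comment> \<open>The two translations, composed in either order, take the common point
    \<open>(x, y)\<close> of \<open>c\<close> and \<open>d\<close> to points with first coordinates
    \<open>z\<close> and \<open>z'\<close>. Both images lie on \<open>sc\<close> and on
    \<open>td\<close>.\<close>
  define z' where "z' = inv m (inv n x)"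
  have z': "n (m z') = x" using F mF unfolding z'_def by simp
  have "z' \<noteq> z" using ne z' unfolding x_def by metis
  moreover have "z' \<in> X" "z' \<noteq> p" using z' xX F mF by (metis B.mem_iff Diff_iff mem_iff singleton_iff)+
  moreover have "sc z = n (f (m (inv f y)))"
    using fixc(2)[of z] c(2) unfolding sc_def x_def by simp
  moreover have "td z = n (f (m (inv f y)))"
    using fixd(1)[of "n z"] d(2) unfolding td_def x_def by simp
  moreover have "c (m z') = n y" using fixc(1)[of "m z'"] z' c(2) by simp
  then have "sc z' = f (m (inv f (n y)))" unfolding sc_def by simp
  moreover have "td (m z') = n y" unfolding td_def using z' d(2) by simp
  then have "td z' = f (m (inv f (n y)))" using fixd(2)[of z'] by simp
  ultimately have "sc = td"
    using unique3[of sc td p z z'] sc(1) td(1) z p by (auto simp: fix1_def)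
  then have "touching X p c d"
    using touching_trans[OF c(1) sc(1) d(1)] sc td touching_sym by metis
  then have "c = d" using touching_eq c(2) d(2) xX by metis
  \<comment> \<open>It remains to refute \<open>c = d\<close>. As \<open>f\<close> is not a tangent
    it has a second fixed point \<open>a\<close>, which \<open>c\<close> must fix too. Hence
    \<open>f\<close> and \<open>c\<close> commute, \<open>f\<close> is an involution, and
    \<open>f = c\<close>.\<close>
  obtain a where a: "a \<in> X - {p}" "f a = a" "f \<noteq> id" using f by (auto simp: tangents_def)
  have C: "c \<in> F" "c p = p" "\<And>w. c (c w) = w" "c \<noteq> id" using c by (auto simp: involutions_def fix1_def)
  have "inv f (c (inv f (c w))) = w" for w using d(3) \<open>c = d\<close> by (auto simp: involutions_def)
  then have fcf: "f (c (f w)) = c w" for w using F C by (metis inv_f)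
  have "f (c a) = c a" using fcf[of a] a by simp
  moreover have "c a \<in> X" "c a \<noteq> p" using a C by (metis Diff_iff mem_iff singleton_iff)+
  ultimately have "c a = a" using unique3[of f id p a "c a"] F id_mem a p by auto
  then have M: "c \<in> fix2 F p a" "f \<in> fix2 F p a" using a C F by (auto simp: fix2_def)
  interpret M: inverted_family "X - {p, a}" "fix2 F p a" "swaps F p a"
    by (rule inverted_family_fix2) (use p a in auto)
  have "f (f w) = w" for w using M.commute[OF M] fcf C by metis
  then have "f = c" using involution_fix2_unique[of p a c f] M a p C by auto
  then show False using y c by simp
qed

section \<open>The stabilizer of a point is a group\<close>

text \<open>If \<open>f\<close> is not a tangent, the tangent \<open>m\<close> relative to
  \<open>f\<close> with \<open>m x = n x\<close> commutes with all tangents by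
  \<open>tangents_commute\<close>. So \<open>m = n\<close>, and \<open>n\<close> has the form
  \<open>inv f \<circ> g\<close>.\<close>

lemma comp_tangent:
  assumes "f \<in> fix1 F p" "n \<in> tangents X F p"
  shows "f \<circ> n \<in> fix1 F p"
proof (cases "f \<in> tangents X F p")
  case True
  then show ?thesis using N.comp_closed assms by (auto simp: tangents_def)
next
  case False
  have F: "f \<in> F" "f p = p" "n \<in> F" "n p = p" using assms by (auto simp: fix1_def tangents_def)
  interpret B: symmetric_permutations X "rebase f F" by (rule base_change) fact
  interpret BN: inverted_family "X - {p}" "tangents X (rebase f F) p" "involutions (rebase f F) p"
    by (rule B.inverted_family_tangents[OF p])
  obtain x where x: "x \<in> X - {p}" using N.nonempty by blast
  then obtain m where m: "m \<in> tangents X (rebase f F) p" "m x = n x"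
    using BN.trans[of x "n x"] assms N.perm by (metis permutes_in_image)
  have "m = n"
    by (rule N.eq_if_commute[OF BN.perm[OF m(1)] N.perm[OF assms(2)] x m(2)])
      (use tangents_commute[OF assms(1) False] m N.commute assms in auto)
  then have "n \<in> fix1 (rebase f F) p" using m by (simp add: tangents_def)
  then obtain g where g: "g \<in> fix1 F p" "n = inv f \<circ> g" using rebase_fix1[OF assms(1)] by blast
  then have "f \<circ> n = g" using F by auto
  then show ?thesis using g by simp
qed

text \<open>If \<open>g\<close> has a second fixed point \<open>q\<close>, a tangent
  \<open>t\<close> with \<open>t (f q) = q\<close> brings \<open>t \<circ> f\<close> into the group
  \<open>fix2 F p q\<close>; afterwards \<open>t\<close> is cancelled from the left.\<close>

lemma comp_fix1:
  assumes "f \<in> fix1 F p" "g \<in> fix1 F p"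
  shows "f \<circ> g \<in> fix1 F p"
  using assms(2)
proof (cases rule: fix1_cases)
  case 1
  then show ?thesis using comp_tangent assms by blast
next
  case (2 q)
  then interpret M: inverted_family "X - {p, q}" "fix2 F p q" "swaps F p q"
    by (intro inverted_family_fix2) (use p in auto)
  have F: "f \<in> F" "f p = p" using assms by (auto simp: fix1_def)
  have comp_tangent_left: "t \<circ> h \<in> fix1 F p" if "h \<in> fix1 F p" "t \<in> tangents X F p" for h t
  proof -
    have F': "h \<in> F" "t \<in> F" using that by (auto simp: fix1_def tangents_def)
    have "inv (inv h \<circ> inv t) \<in> fix1 F p"
      using that inv_fix1 comp_tangent N.inv_closed by blast
    moreover have "inv (inv h \<circ> inv t) = t \<circ> h"
      using o_inv_distrib[OF bij_imp_bij_inv[OF bij[OF F'(1)]] bij_imp_bij_inv[OF bij[OF F'(2)]]] F' by simp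
    ultimately show ?thesis by simp
  qed
  have "f q \<in> X - {p}" using 2 F by (metis Diff_iff inj_iff mem_iff singleton_iff)
  then obtain t where t: "t \<in> tangents X F p" "t (f q) = q" using N.trans[of "f q" q] 2 by auto
  have tF: "t \<in> F" using t by (auto simp: fix1_def tangents_def)
  have "t \<circ> f \<in> fix2 F p q"
    using comp_tangent_left[OF assms(1) t(1)] t by (auto simp: fix1_def fix2_def)
  then have "(t \<circ> f) \<circ> g \<in> fix1 F p" using M.comp_closed 2 by (auto simp: fix2_def fix1_def)
  then have "inv t \<circ> ((t \<circ> f) \<circ> g) \<in> fix1 F p" using comp_tangent_left N.inv_closed t by blast
  moreover have "inv t \<circ> ((t \<circ> f) \<circ> g) = f \<circ> g" using tF by auto
  ultimately show ?thesis by simp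
qed

lemma rebase_fix1_eq:
  assumes "f \<in> fix1 F p"
  shows "fix1 (rebase f F) p = fix1 F p"
proof -
  have F: "f \<in> F" using assms by (auto simp: fix1_def)
  have "inv f \<circ> g \<in> fix1 F p" if "g \<in> fix1 F p" for g using comp_fix1 inv_fix1 assms that by blast
  moreover have "g \<in> (\<circ>) (inv f) ` fix1 F p" if "g \<in> fix1 F p" for g
    using comp_fix1[OF assms that] F by (intro image_eqI[of _ _ "f \<circ> g"]) auto
  ultimately show ?thesis unfolding rebase_fix1[OF assms] by blast
qed

section \<open>Swaps and closure under inversion\<close>

text \<open>The group \<open>fix1 F p\<close> contains \<open>f\<close>, so taking \<open>f\<close>
  as the identity does not change it, nor \<open>fix2 F p q\<close>. Swaps relative to
  \<open>f\<close> therefore invert the original \<open>fix2 F p q\<close>.\<close>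

lemma swap_inverts_fix2:
  assumes "f \<in> fix1 F p" "k \<in> rebase f F" "q \<in> X" "q \<noteq> p" "k p = q" "k q = p" "m \<in> fix2 F p q"
  shows "m (k (m x)) = k x"
proof -
  have F: "f \<in> F" using assms by (auto simp: fix1_def)
  interpret B: symmetric_permutations X "rebase f F" by (rule base_change) fact
  interpret BM: inverted_family "X - {p, q}" "fix2 (rebase f F) p q" "swaps (rebase f F) p q"
    by (rule B.inverted_family_fix2) (use p assms in auto)
  have "m \<in> fix1 (rebase f F) p" using rebase_fix1_eq assms by (auto simp: fix1_def fix2_def)
  then have "m \<in> fix2 (rebase f F) p q" using assms by (auto simp: fix1_def fix2_def)
  moreover have "k \<in> swaps (rebase f F) p q" using assms by (simp add: swaps_def)
  ultimately show ?thesis by (rule BM.inverts)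
qed

end

text \<open>If \<open>g\<close> moves \<open>p\<close>, some \<open>f\<close> fixing \<open>p\<close> makes \<open>f\<^sup>-\<^sup>1 g\<close> swap \<open>p\<close> with \<open>g\<^sup>-\<^sup>1 p\<close>. Such a swap
  inverts \<open>fix2\<close>, hence is determined by one further value; this identifies \<open>g\<^sup>-\<^sup>1\<close> with a
  member of \<open>F\<close>.\<close>

theorem inv_mem:
  assumes "g \<in> F"
  shows "inv g \<in> F"
proof -
  obtain p where p: "p \<in> X" using fourth by blast
  show ?thesis
  proof (cases "g p = p")
    case True
    then show ?thesis using inv_fix1[OF p, of g] assms by (simp add: fix1_def)
  next
    case False
    define a b where "a = inv g p" and "b = g p"
    have ab: "a \<in> X" "b \<in> X" "a \<noteq> p" "b \<noteq> p" "g a = p"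
      using False assms p unfolding a_def b_def by (auto, metis inv_f(2))
    obtain c where c: "c \<in> X" "c \<noteq> p" "c \<noteq> a" using fourth by blast
    obtain c' where c': "c' \<in> X" "c' \<noteq> p" "c' \<noteq> b" using fourth by blast
    obtain f where f: "f \<in> F" "f p = p" "f a = b" using trans3[of p a c p b c'] p ab c c' by auto
    have f1: "f \<in> fix1 F p" using f by (simp add: fix1_def)
    define f' where "f' = inv f"
    have f1': "f' \<in> fix1 F p" unfolding f'_def using inv_fix1[OF p f1] .
    have f': "f' \<in> F" "f' p = p" "f' b = a" "inv f' = f" "\<And>x. f (f' x) = x" "\<And>x. f' (f x) = x"
      using f1' f unfolding f'_def by (auto simp: fix1_def)
    obtain y where y: "y \<in> X" "y \<noteq> p" "y \<noteq> b" using fourth by blast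
    have "inv g p = a" "inv g b = p" using assms unfolding a_def b_def by auto
    then have ne: "inv g y \<noteq> a" "inv g y \<noteq> p" "inv g y \<in> X" using y assms by (metis inv_f(2) inv_in)+
    \<comment> \<open>\<open>h\<close> is the candidate for the inverse: it agrees with
      \<open>inv g\<close> at \<open>p\<close>, \<open>b\<close> and \<open>y\<close>.\<close>
    obtain h where h: "h \<in> F" "h p = a" "h b = p" "h y = inv g y"
      using trans3[of p b y a p "inv g y"] ab p y ne by metis
    \<comment> \<open>\<open>k2\<close> and \<open>k3\<close> both exchange \<open>p\<close> and
      \<open>b\<close> and agree at \<open>y\<close>. Both are inverted by
      \<open>fix2 F p b\<close>: \<open>k2\<close> as a swap relative to \<open>f'\<close>,
      \<open>k3\<close> as the conjugate of the swap \<open>k\<close> by \<open>f\<close>.\<close>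
    define k where "k = f' \<circ> g"
    define k2 where "k2 = f \<circ> h"
    define k3 where "k3 = f \<circ> inv g"
    have k: "k \<in> rebase f F" "k p = a" "k a = p"
      using assms f' ab unfolding k_def by (auto simp: rebase_def f'_def b_def)
    have k2: "k2 \<in> rebase f' F" "k2 p = b" "k2 b = p"
      using h f f' unfolding k2_def by (auto simp: rebase_def)
    interpret Bf: symmetric_permutations X "rebase f F" by (rule base_change) fact
    have kk: "k (k x) = x" for x using Bf.involution[OF k(1), of p a] k ab by metis
    have k3k: "k3 = f \<circ> k \<circ> f'"
    proof
      fix x
      have "k (k (inv g x)) = inv g x" by (rule kk)
      then have "k (f' x) = inv g x" unfolding k_def using assms by simp
      then show "k3 x = (f \<circ> k \<circ> f') x" unfolding k3_def by simp
    qed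
    interpret M: inverted_family "X - {p, b}" "fix2 F p b" "swaps F p b"
      by (rule inverted_family_fix2) (use p ab in auto)
    have "h = inv g"
    proof
      fix x
      consider "x = p" | "x = b" | "x \<notin> X" | "x \<in> X - {p, b}" by blast
      then show "h x = inv g x"
      proof cases
        case 4
        then obtain m where m: "m \<in> fix2 F p b" "m y = x" using M.trans[of y x] y by auto
        have mF: "m \<in> F" "m p = p" "m b = b" using m by (auto simp: fix2_def)
        have m2: "m (k2 (m w)) = k2 w" for w
          using swap_inverts_fix2[OF p f1' k2(1)] k2 ab m by blast
        have "f' \<circ> m \<circ> f \<in> fix1 F p"
          using comp_fix1[OF p] f1 f1' mF by (simp add: fix1_def)
        then have m': "f' \<circ> m \<circ> f \<in> fix2 F p a" using f f' mF by (auto simp: fix1_def fix2_def)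
        have "f' (m (f (k (f' (m (f w)))))) = k w" for w
          using swap_inverts_fix2[OF p f1 k(1) _ _ _ _ m', of w] k ab by simp
        then have m3: "m (k3 (m w)) = k3 w" for w unfolding k3k using f'(5,6) by (metis comp_apply)
        have "k2 y = k3 y" unfolding k2_def k3_def using h by simp
        then have "m (k2 x) = m (k3 x)" using m2 m3 m by metis
        then have "f (h x) = f (inv g x)" using mF unfolding k2_def k3_def by simp
        then show ?thesis using f by simp
      qed (use h assms ab in \<open>auto simp: a_def b_def outside\<close>, metis inv_f(1) outside)
    qed
    then show ?thesis using h by simp
  qed
qed

end

section \<open>Coordinates with respect to a circle\<close>

text \<open>Projection onto \<open>K\<close> along the generators of the class \<open>S\<close>; on
  a fixed circle the two classes give the two coordinates.\<close>

definition trace :: "'a set set \<Rightarrow> 'a set \<Rightarrow> 'a \<Rightarrow> 'a" where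
  "trace S K p = (THE x. x \<in> gen_through S p \<inter> K)"

context hyperbola_structure
begin

lemma circle_points: "K \<in> C \<Longrightarrow> p \<in> K \<Longrightarrow> p \<in> P"
  using circles_subset by auto

lemma trace:
  assumes "p \<in> P" "S \<in> {S1, S2}" "K \<in> C"
  shows "trace S K p \<in> K" "trace S K p \<in> P" "gen_through S (trace S K p) = gen_through S p"
proof -
  have g: "gen_through S p \<in> S" using gen_through assms by blast
  then have "\<exists>!x. x \<in> gen_through S p \<inter> K" using H3 assms by blast
  from theI'[OF this] have *: "trace S K p \<in> gen_through S p" "trace S K p \<in> K"
    unfolding trace_def by auto
  then show "trace S K p \<in> K" "gen_through S (trace S K p) = gen_through S p"
    using gen_through_eq[OF g] assms by auto
  then show "trace S K p \<in> P" using circle_points assms by blast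
qed

lemma trace_eq:
  assumes "q \<in> K" "p \<in> P" "S \<in> {S1, S2}" "K \<in> C" "gen_through S q = gen_through S p"
  shows "trace S K p = q"
proof -
  have "gen_through S p \<in> S" using gen_through assms by blast
  then have "\<exists>!x. x \<in> gen_through S p \<inter> K" using H3 assms by blast
  moreover have "q \<in> P" using circle_points assms by blast
  then have "q \<in> gen_through S p \<inter> K" using gen_through(2)[of q S] assms by simp
  ultimately show ?thesis unfolding trace_def by (rule the1_equality)
qed

context
  fixes I assumes I: "I \<in> C"
begin

abbreviation x_of :: "'a \<Rightarrow> 'a" where "x_of \<equiv> trace S1 I"
abbreviation y_of :: "'a \<Rightarrow> 'a" where "y_of \<equiv> trace S2 I"
abbreviation point :: "'a \<Rightarrow> 'a \<Rightarrow> 'a" where "point \<equiv> gen_meet S1 S2"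

lemma coord_in: "p \<in> P \<Longrightarrow> x_of p \<in> I" "p \<in> P \<Longrightarrow> y_of p \<in> I"
  using trace I by simp_all

lemma I_points: "a \<in> I \<Longrightarrow> a \<in> P"
  using circle_points I by blast

lemma coord_I: "a \<in> I \<Longrightarrow> x_of a = a" "a \<in> I \<Longrightarrow> y_of a = a"
  using trace_eq I I_points by simp_all

lemma coord_eq_iff:
  assumes "p \<in> P" "q \<in> P" "S \<in> {S1, S2}" "K \<in> C"
  shows "trace S K p = trace S K q \<longleftrightarrow> gen_through S p = gen_through S q"
proof
  show "trace S K p = trace S K q \<Longrightarrow> gen_through S p = gen_through S q"
    using trace(3)[OF assms(1,3,4)] trace(3)[OF assms(2-4)] by simp
qed (simp add: trace_def)

lemma coord_meet:
  assumes "p \<in> P" "q \<in> P"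
  shows "x_of (point p q) = x_of p" "y_of (point p q) = y_of q"
  using gen_meet[OF assms] coord_eq_iff[of "point p q" p S1] coord_eq_iff[of "point p q" q S2] assms I
  by simp_all

lemma coord_point:
  assumes "a \<in> I" "b \<in> I"
  shows "x_of (point a b) = a" "y_of (point a b) = b" "point a b \<in> P"
  using coord_meet[of a b] gen_meet(3)[of a b] coord_I assms I_points by simp_all

lemma coord_ext:
  assumes "p \<in> P" "q \<in> P" "x_of p = x_of q" "y_of p = y_of q"
  shows "p = q"
proof -
  have "gen_through S1 p = gen_through S1 q" "gen_through S2 p = gen_through S2 q"
    using coord_eq_iff assms I by blast+
  moreover have "r \<in> gen_through S1 r" "r \<in> gen_through S2 r" if "r \<in> P" for r
    using gen_through(2) that by blast+
  ultimately have "point p p = p" "point p p = q"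
    using gen_meet_unique[OF assms(1,1)] assms(1,2) by metis+
  then show ?thesis by simp
qed

text \<open>The circle \<open>K\<close> read as the graph of a map on \<open>I\<close>, extended by
  the identity as \<open>permutes\<close> requires.\<close>

definition perm_of :: "'a set \<Rightarrow> 'a \<Rightarrow> 'a" where
  "perm_of K a = (if a \<in> I then y_of (trace S1 K a) else a)"

lemma mem_circle_iff:
  assumes "K \<in> C" "p \<in> P"
  shows "p \<in> K \<longleftrightarrow> perm_of K (x_of p) = y_of p"
proof -
  define q where "q = trace S1 K (x_of p)"
  have xp: "x_of p \<in> I" "x_of p \<in> P" using coord_in I_points assms by blast+
  then have q: "q \<in> K" "q \<in> P" "gen_through S1 q = gen_through S1 p"
    using trace[of "x_of p" S1 K] trace(3)[of p S1 I] assms I unfolding q_def by simp_all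
  have perm: "perm_of K (x_of p) = y_of q" using xp by (simp add: perm_of_def q_def)
  have "p \<in> K \<Longrightarrow> q = p"
    using trace_eq[of p K "x_of p" S1] trace(3)[of p S1 I] assms xp I unfolding q_def by simp
  moreover have "y_of q = y_of p \<Longrightarrow> q = p"
    using coord_ext[of q p] coord_eq_iff[of q p S1 I] q assms I by simp
  ultimately show ?thesis using perm q by auto
qed

lemma point_mem_circle_iff:
  assumes "K \<in> C" "a \<in> I" "b \<in> I"
  shows "point a b \<in> K \<longleftrightarrow> perm_of K a = b"
  using mem_circle_iff[OF assms(1) coord_point(3)] coord_point assms by simp

lemma perm_of_permutes:
  assumes "K \<in> C"
  shows "perm_of K permutes I"
proof -
  have in_I: "perm_of K a \<in> I \<longleftrightarrow> a \<in> I" for a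
    using coord_in(2)[OF trace(2)[of a S1 K]] assms I_points by (simp add: perm_of_def)
  have "\<exists>!a. perm_of K a = b" if b: "b \<in> I" for b
  proof -
    define q where "q = trace S2 K b"
    have q: "q \<in> K" "q \<in> P" "y_of q = b"
      using trace[of b S2 K] coord_eq_iff[of q b S2 I] coord_I b assms I I_points unfolding q_def
      by simp_all
    show ?thesis
    proof (rule ex1I[of _ "x_of q"])
      show "perm_of K (x_of q) = b" using mem_circle_iff assms q by blast
    next
      fix a assume a: "perm_of K a = b"
      then have aI: "a \<in> I" using in_I b by auto
      then have "point a b \<in> K" using point_mem_circle_iff a assms b by blast
      moreover have "gen_through S2 (point a b) = gen_through S2 b"
        using gen_meet(5) aI b I_points by blast
      ultimately have "q = point a b" unfolding q_def
        using trace_eq assms b I_points by blast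
      then show "a = x_of q" using coord_point aI b by simp
    qed
  qed
  moreover have "\<exists>!a. perm_of K a = b" if b: "b \<notin> I" for b
    using in_I b by (metis perm_of_def)
  moreover have "perm_of K a = a" if "a \<notin> I" for a using that by (simp add: perm_of_def)
  ultimately show ?thesis unfolding permutes_def by blast
qed

lemma circle_symmetry_eqI:
  assumes "K \<in> C" "p \<in> P" "q \<in> P" "perm_of K (x_of p) = y_of q" "perm_of K (x_of q) = y_of p"
  shows "circle_symmetry P S1 S2 K p = q"
proof -
  have "point p q \<in> K" "point q p \<in> K"
    using mem_circle_iff[OF assms(1)] gen_meet(3) coord_meet assms by simp_all
  then show ?thesis unfolding circle_symmetry_def
    by (intro the1_equality[OF circle_symmetry_ex1]) (use assms in auto)
qed

lemma perm_of_self: "perm_of I = id"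
proof
  fix a
  show "perm_of I a = id a"
    by (cases "a \<in> I") (simp_all add: perm_of_def coord_I)
qed

text \<open>Three common values are three common points on pairwise different generators, so (H4)
  applies.\<close>

lemma perm_of_inj:
  assumes "K \<in> C" "L \<in> C" "a \<in> I" "b \<in> I" "c \<in> I" "a \<noteq> b" "a \<noteq> c" "b \<noteq> c"
    and "perm_of K a = perm_of L a" "perm_of K b = perm_of L b" "perm_of K c = perm_of L c"
  shows "K = L"
proof -
  let ?p = "\<lambda>x. point x (perm_of K x)"
  have "perm_of K x \<in> I" if "x \<in> I" for x
    using that perm_of_permutes[OF assms(1)] permutes_in_image by metis
  note pK = this
  have p: "?p x \<in> P" "x_of (?p x) = x" "y_of (?p x) = perm_of K x" if "x \<in> I" for x
    using coord_point that pK by blast+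
  have dist: "gen_through S (?p x) \<noteq> gen_through S (?p y)"
    if "x \<in> I" "y \<in> I" "x \<noteq> y" "S \<in> {S1, S2}" for x y S
  proof -
    have "perm_of K x \<noteq> perm_of K y"
      using that perm_of_permutes[OF assms(1)] permutes_inj injD by metis
    then have "trace S I (?p x) \<noteq> trace S I (?p y)" using p that by auto
    then show ?thesis using coord_eq_iff[of "?p x" "?p y" S I] p that I by blast
  qed
  have ne: "?p x \<noteq> ?p y" if "x \<in> I" "y \<in> I" "x \<noteq> y" for x y
    using p that by metis
  have "\<exists>!M. M \<in> C \<and> ?p a \<in> M \<and> ?p b \<in> M \<and> ?p c \<in> M"
    by (rule H4) (use p ne dist assms in \<open>blast+\<close>)
  moreover have "?p x \<in> K" if "x \<in> I" for x
    using point_mem_circle_iff[OF assms(1) that pK] that by blast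
  moreover have "?p x \<in> L" if "x \<in> I" "perm_of K x = perm_of L x" for x
    using point_mem_circle_iff[OF assms(2) that(1) pK[OF that(1)]] that(2) by simp
  ultimately show ?thesis using assms by metis
qed

lemma perm_of_ex:
  assumes "a \<in> I" "b \<in> I" "c \<in> I" "a \<noteq> b" "a \<noteq> c" "b \<noteq> c"
    and "a' \<in> I" "b' \<in> I" "c' \<in> I" "a' \<noteq> b'" "a' \<noteq> c'" "b' \<noteq> c'"
  obtains K where "K \<in> C" "perm_of K a = a'" "perm_of K b = b'" "perm_of K c = c'"
proof -
  have dist: "gen_through S (point x x') \<noteq> gen_through S (point y y')"
    if "x \<in> I" "y \<in> I" "x' \<in> I" "y' \<in> I" "x \<noteq> y" "x' \<noteq> y'" "S \<in> {S1, S2}" for x y x' y' S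
  proof -
    have "trace S I (point x x') \<noteq> trace S I (point y y')" using coord_point that by auto
    then show ?thesis
      using coord_eq_iff[of "point x x'" "point y y'" S I] coord_point that I by blast
  qed
  have ne: "point x x' \<noteq> point y y'" if "x \<in> I" "y \<in> I" "x' \<in> I" "y' \<in> I" "x \<noteq> y" for x y x' y'
    using coord_point that by metis
  have "\<exists>!M. M \<in> C \<and> point a a' \<in> M \<and> point b b' \<in> M \<and> point c c' \<in> M"
  proof (rule H4)
    show "point a a' \<in> P" "point b b' \<in> P" "point c c' \<in> P" using coord_point assms by simp_all
    show "point a a' \<noteq> point b b'" "point b b' \<noteq> point c c'" "point c c' \<noteq> point a a'"
      using ne assms by simp_all
    fix S assume S: "S \<in> {S1, S2}"
    show "gen_through S (point a a') \<noteq> gen_through S (point b b') \<and>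
      gen_through S (point b b') \<noteq> gen_through S (point c c') \<and>
      gen_through S (point c c') \<noteq> gen_through S (point a a')"
      by (intro conjI dist S) (use assms in simp_all)
  qed
  then show thesis using that point_mem_circle_iff assms by metis
qed

text \<open>(H5) provides one circle with three points; projecting it along \<open>S1\<close>
  carries them to \<open>I\<close>.\<close>

lemma circle_three_points:
  obtains a b c where "a \<in> I" "b \<in> I" "c \<in> I" "a \<noteq> b" "a \<noteq> c" "b \<noteq> c"
proof -
  obtain K a b c where K: "K \<in> C" "a \<in> K" "b \<in> K" "c \<in> K" "a \<noteq> b" "b \<noteq> c" "c \<noteq> a"
    using H5 by blast
  have "x_of p \<noteq> x_of q" if "p \<in> K" "q \<in> K" "p \<noteq> q" for p q
    using that K(1) coord_ext mem_circle_iff circle_points by metis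
  then have "x_of a \<noteq> x_of b" "x_of a \<noteq> x_of c" "x_of b \<noteq> x_of c" using K by metis+
  then show thesis using that coord_in circle_points K by metis
qed

section \<open>The circle symmetry as a swap of coordinates\<close>

lemma circle_symmetry_base:
  assumes "p \<in> P"
  shows "circle_symmetry P S1 S2 I p \<in> P" "x_of (circle_symmetry P S1 S2 I p) = y_of p"
    "y_of (circle_symmetry P S1 S2 I p) = x_of p"
proof -
  let ?q = "point (y_of p) (x_of p)"
  have q: "?q \<in> P" "x_of ?q = y_of p" "y_of ?q = x_of p" using coord_in coord_point assms by simp_all
  then have "circle_symmetry P S1 S2 I p = ?q"
    by (intro circle_symmetry_eqI) (use assms I perm_of_self in auto)
  then show "circle_symmetry P S1 S2 I p \<in> P" "x_of (circle_symmetry P S1 S2 I p) = y_of p"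
    "y_of (circle_symmetry P S1 S2 I p) = x_of p" using q by simp_all
qed

lemma circle_symmetry_involution:
  assumes "p \<in> P"
  shows "circle_symmetry P S1 S2 I (circle_symmetry P S1 S2 I p) = p"
  by (rule coord_ext) (use circle_symmetry_base assms in simp_all)

lemma circle_symmetry_image:
  assumes "A \<subseteq> P" "B \<subseteq> P" "\<And>p. p \<in> P \<Longrightarrow> p \<in> A \<longleftrightarrow> circle_symmetry P S1 S2 I p \<in> B"
  shows "circle_symmetry P S1 S2 I ` A = B"
proof
  show "circle_symmetry P S1 S2 I ` A \<subseteq> B" using assms by blast
  show "B \<subseteq> circle_symmetry P S1 S2 I ` A"
  proof
    fix p assume p: "p \<in> B"
    then have "p \<in> P" using assms by blast
    then have "circle_symmetry P S1 S2 I p \<in> A"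
      using assms(3)[of "circle_symmetry P S1 S2 I p"] circle_symmetry_base(1)
        circle_symmetry_involution p by simp
    then show "p \<in> circle_symmetry P S1 S2 I ` A"
      using circle_symmetry_involution[OF \<open>p \<in> P\<close>] by (metis imageI)
  qed
qed

text \<open>Generators become level sets of one coordinate, which the swap exchanges.\<close>

lemma generator_iff:
  assumes "S \<in> {S1, S2}"
  shows "A \<in> S \<longleftrightarrow> (\<exists>a\<in>I. A = {p \<in> P. trace S I p = a})"
proof -
  have "gen_through S a = {p \<in> P. trace S I p = a}" if a: "a \<in> I" for a
  proof -
    have aP: "a \<in> P" and tr: "trace S I a = a" using a I_points coord_I assms by auto
    have "gen_through S a \<in> S" using gen_through aP assms by blast
    then have "gen_through S a \<subseteq> P" "p \<in> gen_through S a \<Longrightarrow> gen_through S p = gen_through S a" for p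
      using gen_through_eq[OF _ _ assms] assms gens1_subset gens2_subset by auto
    then have "p \<in> gen_through S a \<longleftrightarrow> p \<in> P \<and> gen_through S p = gen_through S a" for p
      using gen_through(2)[OF _ assms, of p] by (metis subsetD)
    then show ?thesis using coord_eq_iff[OF _ aP assms I] tr by auto
  qed
  note gen = this
  show ?thesis
  proof
    assume A: "A \<in> S"
    then obtain a where a: "a \<in> A" "a \<in> I" using H3[OF _ I] assms by blast
    then have "A = gen_through S a" using gen_through_eq A assms by metis
    then show "\<exists>a\<in>I. A = {p \<in> P. trace S I p = a}" using gen a by blast
  next
    assume "\<exists>a\<in>I. A = {p \<in> P. trace S I p = a}"
    then show "A \<in> S" using gen gen_through(1) I_points assms by metis
  qed
qed

lemma circle_symmetry_generators:
  "(`) (circle_symmetry P S1 S2 I) ` (S1 \<union> S2) = S1 \<union> S2"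
proof -
  let ?s = "circle_symmetry P S1 S2 I"
  have img: "?s ` {p \<in> P. x_of p = a} = {p \<in> P. y_of p = a}"
    "?s ` {p \<in> P. y_of p = a} = {p \<in> P. x_of p = a}" for a
    by (rule circle_symmetry_image; use circle_symmetry_base in auto)+
  define G1 G2 where "G1 = (\<lambda>a. {p \<in> P. x_of p = a}) ` I" and "G2 = (\<lambda>a. {p \<in> P. y_of p = a}) ` I"
  have "(`) ?s ` G1 = G2" "(`) ?s ` G2 = G1"
    unfolding G1_def G2_def by (simp_all only: image_image img)
  moreover have "S1 = G1" "S2 = G2" unfolding G1_def G2_def using generator_iff by blast+
  ultimately show ?thesis by (metis image_Un Un_commute)
qed

lemma circle_symmetry_bij: "bij_betw (circle_symmetry P S1 S2 I) P P"
  by (rule bij_betw_byWitness[where f' = "circle_symmetry P S1 S2 I"])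
    (use circle_symmetry_base circle_symmetry_involution in auto)

end
end

section \<open>The symmetry axiom in coordinates and the images of circles\<close>

context symmetric_minkowski_plane
begin

text \<open>A point \<open>p\<close> outside \<open>K\<close> with \<open>S\<^sub>K(p)\<close> on \<open>L\<close> is a pair \<open>x \<noteq> z\<close> exchanged by
  \<open>f\<^sup>-\<^sup>1 g\<close>, where \<open>f, g\<close> are the permutations of \<open>K, L\<close>; so (S) says that \<open>f\<^sup>-\<^sup>1 g\<close> is an
  involution as soon as it has a 2-cycle.\<close>

lemma symmetric_permutations_perm_of:
  assumes I: "I \<in> C" and fourth: "\<And>a b c. \<exists>d\<in>I. d \<noteq> a \<and> d \<noteq> b \<and> d \<noteq> c"
  shows "symmetric_permutations I (perm_of I ` C)"
proof
  show "f permutes I" if "f \<in> perm_of I ` C" for f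
    using that perm_of_permutes[OF I] by blast
  show "\<exists>d\<in>I. d \<noteq> a \<and> d \<noteq> b \<and> d \<noteq> c" for a b c by (rule fourth)
  show "\<exists>f\<in>perm_of I ` C. f a = a' \<and> f b = b' \<and> f c = c'"
    if "a \<in> I" "b \<in> I" "c \<in> I" "a \<noteq> b" "a \<noteq> c" "b \<noteq> c"
      "a' \<in> I" "b' \<in> I" "c' \<in> I" "a' \<noteq> b'" "a' \<noteq> c'" "b' \<noteq> c'" for a b c a' b' c'
    using perm_of_ex[OF I that] by blast
  show "f = g" if "f \<in> perm_of I ` C" "g \<in> perm_of I ` C" "a \<in> I" "b \<in> I" "c \<in> I"
    "a \<noteq> b" "a \<noteq> c" "b \<noteq> c" "f a = g a" "f b = g b" "f c = g c" for f g a b c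
    using that perm_of_inj[OF I _ _ that(3-8)] by blast
  show "id \<in> perm_of I ` C" using perm_of_self[OF I] I by (metis imageI)
next
  fix f g x z y w
  assume fg: "f \<in> perm_of I ` C" "g \<in> perm_of I ` C" and xz: "x \<in> I" "z \<in> I" "x \<noteq> z"
    and eq: "f z = g x" "g z = f x" and yw: "y \<in> I" "w \<in> I" "f w = g y"
  obtain K L where K: "K \<in> C" "f = perm_of I K" and L: "L \<in> C" "g = perm_of I L" using fg by blast
  have perm: "f permutes I" "g permutes I" using K L perm_of_permutes[OF I] by blast+
  then have fI: "f a \<in> I" "g a \<in> I" if "a \<in> I" for a using that by (simp_all add: permutes_in_image)
  let ?m = "gen_meet S1 S2"
  have sym: "circle_symmetry P S1 S2 K (?m a (g a)) = ?m b (f a)"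
    if ab: "a \<in> I" "b \<in> I" "f b = g a" for a b
    by (rule circle_symmetry_eqI[OF I K(1)])
      (use coord_point[OF I] fI ab K in simp_all)
  have mem: "?m a b \<in> L \<longleftrightarrow> g a = b" if "a \<in> I" "b \<in> I" for a b
    using point_mem_circle_iff[OF I L(1) that] L by simp
  \<comment> \<open>The point with coordinates \<open>x\<close>, \<open>g x\<close> lies on
    \<open>L\<close> but not on \<open>K\<close>, and the symmetry in \<open>K\<close> takes it to
    the point with coordinates \<open>z\<close>, \<open>f x = g z\<close>, again on
    \<open>L\<close>.\<close>
  have "f x \<noteq> g x" using eq xz perm by (metis permutes_inj injD)
  then have "?m x (g x) \<notin> K" using point_mem_circle_iff[OF I K(1) xz(1) fI(2)] xz K by simp
  moreover have "circle_symmetry P S1 S2 K (?m x (g x)) \<in> L"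
    using sym[OF xz(1,2) eq(1)] mem[OF xz(2) fI(1)] xz eq by simp
  ultimately have "orthogonal P S1 S2 K L"
    using symmetry_axiom[OF K(1) L(1), of "?m x (g x)"] mem xz fI by blast
  then have "circle_symmetry P S1 S2 K (?m y (g y)) \<in> L"
    using mem yw fI unfolding orthogonal_def by blast
  then show "g w = f y" using sym[OF yw] mem[OF yw(2) fI(1)] yw by simp
qed

text \<open>Without a fourth point, \<open>I\<close> has exactly three points, and then every
  permutation of \<open>I\<close> comes from a circle by \<open>perm_of_ex\<close>.\<close>

lemma inverse_circle:
  assumes I: "I \<in> C" and K: "K \<in> C"
  obtains L where "L \<in> C" "perm_of I L = inv (perm_of I K)"
proof (cases "\<forall>a b c. \<exists>d\<in>I. d \<noteq> a \<and> d \<noteq> b \<and> d \<noteq> c")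
  case True
  then interpret symmetric_permutations I "perm_of I ` C"
    by (intro symmetric_permutations_perm_of I) blast
  show thesis using inv_mem[of "perm_of I K"] K that by (metis imageE imageI)
next
  case False
  then obtain a b c where abc: "I \<subseteq> {a, b, c}" by blast
  obtain u v w where u: "u \<in> I" "v \<in> I" "w \<in> I" "u \<noteq> v" "u \<noteq> w" "v \<noteq> w"
    using circle_three_points[OF I] by blast
  have "card I \<le> card {u, v, w}"
    using u card_mono[OF _ abc] by (simp add: card_insert_if split: if_splits)
  then have I_eq: "I = {u, v, w}"
    using card_seteq[of I "{u, v, w}"] u abc finite_subset[OF abc] by auto
  have p: "inv (perm_of I K) permutes I" using perm_of_permutes[OF I K] by (rule permutes_inv)
  let ?g = "inv (perm_of I K)"
  have "?g u \<in> I" "?g v \<in> I" "?g w \<in> I" "?g u \<noteq> ?g v" "?g u \<noteq> ?g w" "?g v \<noteq> ?g w"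
    using p u permutes_in_image[OF p] permutes_inj[OF p] by (auto dest: injD)
  then obtain L where L: "L \<in> C" "perm_of I L u = ?g u" "perm_of I L v = ?g v" "perm_of I L w = ?g w"
    using perm_of_ex[OF I u] by metis
  have "perm_of I L x = ?g x" for x
  proof (cases "x \<in> I")
    case True
    then show ?thesis using L unfolding I_eq by blast
  next
    case False
    then show ?thesis using permutes_not_in[OF p] permutes_not_in[OF perm_of_permutes[OF I L(1)]] by simp
  qed
  then show thesis using that L by blast
qed

text \<open>Swapping coordinates turns the graph of a permutation into the graph of its
  inverse.\<close>

lemma circle_symmetry_circle:
  assumes I: "I \<in> C" and K: "K \<in> C"
  shows "circle_symmetry P S1 S2 I ` K \<in> C"
proof -
  obtain L where L: "L \<in> C" "perm_of I L = inv (perm_of I K)" using inverse_circle assms by blast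
  have "circle_symmetry P S1 S2 I ` K = L"
  proof (rule circle_symmetry_image[OF I])
    show "K \<subseteq> P" "L \<subseteq> P" using circles_subset K L by auto
    fix p assume p: "p \<in> P"
    let ?q = "circle_symmetry P S1 S2 I p"
    have "?q \<in> L \<longleftrightarrow> inv (perm_of I K) (trace S2 I p) = trace S1 I p"
      using mem_circle_iff[OF I L(1), of ?q] circle_symmetry_base[OF I p] L by simp
    also have "\<dots> \<longleftrightarrow> perm_of I K (trace S1 I p) = trace S2 I p"
      using permutes_inv_eq[OF perm_of_permutes[OF I K]] by auto
    finally show "p \<in> K \<longleftrightarrow> ?q \<in> L" using mem_circle_iff[OF I K p] by simp
  qed
  then show ?thesis using L by simp
qed

end

theorem theorem2p1:
  fixes P :: "'a set" and C S1 S2 :: "'a set set"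
  assumes "symmetric_minkowski_plane P C S1 S2"
    and "I \<in> C"
  shows "plane_automorphism P C S1 S2 (circle_symmetry P S1 S2 I)"
proof -
  interpret symmetric_minkowski_plane P C S1 S2 by fact
  let ?s = "circle_symmetry P S1 S2 I"
  have "K \<in> (`) ?s ` C" if K: "K \<in> C" for K
  proof (rule image_eqI)
    have "?s ` ?s ` K = (\<lambda>p. p) ` K"
      unfolding image_image using circle_symmetry_involution assms(2) circle_points K by (intro image_cong) auto
    then show "K = ?s ` ?s ` K" by simp
    show "?s ` K \<in> C" using circle_symmetry_circle assms(2) K by blast
  qed
  then have "(`) ?s ` C = C" using circle_symmetry_circle assms(2) by blast
  then show ?thesis
    unfolding plane_automorphism_def
    using circle_symmetry_bij[OF assms(2)] circle_symmetry_generators[OF assms(2)] by (intro conjI)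
qed

end
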